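(* Let $p, n \ge 1$ be integers and let $p = p_S + p_C$ with integers $p_S \ge 1$, $p_C \ge 0$. Let $\mathbf{x} \in \mathbb{R}^{p}$ and $\mathbf{v} \in \mathbb{R}^{n}$ be zero-mean, mutually uncorrelated random vectors with covariance matrices $\mathbf{K}_{\mathbf{x}}$ and $\mathbf{K}_{\mathbf{v}}$, and let $\mathbf{A} \in \mathbb{R}^{n \times p}$ be a random matrix, independent of $(\mathbf{x},\mathbf{v})$, whose rows are i.i.d. $\mathcal{N}(0, I_p)$. The observations are $\mathbf{y} = \mathbf{A}\mathbf{x} + \mathbf{v}$. Fix a set of $p_S$ indices; let $\mathbf{x}_S \in \mathbb{R}^{p_S}$ be the subvector of $\mathbf{x}$ with these indices and $\mathbf{x}_C \in \mathbb{R}^{p_C}$ the subvector of the remaining entries, and let $\mathbf{A}_S \in \mathbb{R}^{n\times p_S}$, $\mathbf{A}_C \in \mathbb{R}^{n \times p_C}$ be the corresponding column submatrices of $\mathbf{A}$. Let $\mathbf{K}_{\mathbf{x}_S}$, $\mathbf{K}_{\mathbf{x}_C}$ be the covariance matrices of $\mathbf{x}_S$, $\mathbf{x}_C$. Consider the partial (mismatched) LMMSE estimator $$\mathbf{W}_S = \hat{\mathbf{K}}_{\mathbf{x}_S}\mathbf{A}_S^{\mathrm T}\big(\mathbf{A}_S \hat{\mathbf{K}}_{\mathbf{x}_S}\mathbf{A}_S^{\mathrm T} + \hat{\mathbf{K}}_{\mathbf{z}}\big)^{+}$$ with assumed covariances $\hat{\mathbf{K}}_{\mathbf{x}_S} =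 I_{p_S}$ and $\hat{\mathbf{K}}_{\mathbf{z}} = 0$, and define the expected MSE $$\varepsilon_S(p_S,n) = \mathbb{E}_{\mathbf{A}}\Big[\,\mathbb{E}_{\mathbf{x},\mathbf{v}}\big[\|\mathbf{x}_S - \mathbf{W}_S\mathbf{y}\|^2\big]\Big].$$ Then $$\varepsilon_S(p_S,n) = \operatorname{tr}(\mathbf{K}_{\mathbf{x}_S})\Big(1 - \frac{\min\{p_S,n\}}{p_S}\Big) + \gamma\Big(\operatorname{tr}(\mathbf{K}_{\mathbf{x}_C}) + \frac{1}{n}\operatorname{tr}(\mathbf{K}_{\mathbf{v}})\Big),$$ where $\gamma = \frac{p_S}{n-p_S-1}$ if $p_S < n-1$, $\gamma = \frac{n}{p_S - n - 1}$ if $p_S > n+1$, and $\gamma = +\infty$ otherwise.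
   Context: $\mathbf{M}^{+}$ denotes the Moore–Penrose pseudoinverse and $\mathbf{M}^{\mathrm T}$ the transpose; $\|\cdot\|$ is the Euclidean norm. The estimate of $\mathbf{x}_S$ is $\hat{\mathbf{x}}_S = \mathbf{W}_S\mathbf{y}$, which is computed assuming (incorrectly) the model $\mathbf{y} = \mathbf{A}_S\mathbf{x}_S + \mathbf{z}$, while $\mathbf{y}$ is actually generated by $\mathbf{y} = \mathbf{A}\mathbf{x}+\mathbf{v}$. The inner expectation is over $(\mathbf{x},\mathbf{v})$ for fixed $\mathbf{A}$, and the outer expectation is over $\mathbf{A}$. *)

theory Defs
  imports "HOL-Probability.Probability"
begin

text \<open>Moore--Penrose pseudoinverse of a square real matrix, defined via the four
  Penrose conditions (it exists and is unique).\<close>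
definition mp_pinv :: "real^'n^'n \<Rightarrow> real^'n^'n" where
  "mp_pinv M = (THE X. M ** X ** M = M \<and> X ** M ** X = X \<and>
                       transpose (M ** X) = M ** X \<and> transpose (X ** M) = X ** M)"

definition gaussian_matrix :: "(real^'p^'n) measure" where
  "gaussian_matrix = density lborel (\<lambda>A. ennreal (\<Prod>i\<in>UNIV. \<Prod>j\<in>UNIV. std_normal_density (A$i$j)))"

text \<open>The matrix A_S Khat_{x_S} A_S^T + Khat_z with Khat_{x_S} = I and Khat_z = 0, i.e.
  A_S A_S^T, where A_S consists of the columns of A with index in S.\<close>
definition gram_S :: "'p set \<Rightarrow> real^'p^'n \<Rightarrow> real^'n^'n" where
  "gram_S S A = (\<chi> i j. (\<Sum>k\<in>S. A$i$k * 1 * A$j$k) + 0)"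

text \<open>Entry k (for k in S) of W_S y, where
  W_S = Khat_{x_S} A_S^T (A_S Khat_{x_S} A_S^T + Khat_z)^+ with Khat_{x_S} = I, Khat_z = 0.\<close>
definition WS_apply :: "'p set \<Rightarrow> real^'p^'n \<Rightarrow> real^'n \<Rightarrow> 'p \<Rightarrow> real" where
  "WS_apply S A y k = (\<Sum>i\<in>UNIV. A$i$k * (mp_pinv (gram_S S A) *v y)$i)"

definition sq_err_S :: "'p set \<Rightarrow> real^'p^'n \<Rightarrow> real^'p \<Rightarrow> real^'n \<Rightarrow> real" where
  "sq_err_S S A x v = (\<Sum>k\<in>S. (x$k - WS_apply S A (A *v x + v) k)\<^sup>2)"

definition gamma_S :: "nat \<Rightarrow> nat \<Rightarrow> ennreal" where
  "gamma_S pS n = (if pS + 1 < n then ennreal (real pS / (real n - real pS - 1))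
                   else if pS > n + 1 then ennreal (real n / (real pS - real n - 1))
                   else \<infinity>)"

end

theory Submission
  imports Defs "HOL-Real_Asymp.Real_Asymp"
begin

text \<open>Let \<open>B\<close> be \<open>A\<close> with the columns outside \<open>S\<close> set to zero and \<open>W\<close> its pseudoinverse. Then the estimate is
  \<open>W y\<close>, and since \<open>x\<^sub>S - W B x\<^sub>S\<close> is orthogonal to the range of \<open>W\<close>, the squared error is
  \<open>\<parallel>x\<^sub>S - W B x\<^sub>S\<parallel>\<^sup>2 + \<parallel>W (A\<^sub>C x\<^sub>C + v)\<parallel>\<^sup>2\<close> pointwise, so by Tonelli one may integrate over \<open>A\<close> first, for
  fixed \<open>x\<close> and \<open>v\<close>. Rotation invariance of the Gaussian measure turns the first mean into
  \<open>\<parallel>x\<^sub>S\<parallel>\<^sup>2 (1 - rank B / p\<^sub>S)\<close> and, as \<open>A\<^sub>C\<close> is independent of \<open>W\<close>, the second into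
  \<open>(\<parallel>x\<^sub>C\<parallel>\<^sup>2 + \<parallel>v\<parallel>\<^sup>2 / n) E (tr (W\<^sup>T W))\<close>. The last trace is the trace of the inverse Gram matrix of
  the rows (or columns) of \<open>B\<close>. Its diagonal entries are the inverse squared distances of one row from the span
  of the others; conditionally on the others such a squared distance is chi-squared with
  \<open>k = \<bar>n - p\<^sub>S\<bar> + 1\<close> degrees of freedom, whose inverse has mean
  \<open>\<integral>\<^sub>0\<^sup>\<infinity> (1 + 2 t) powr (- k / 2) dt\<close>, which is \<open>1 / (k - 2)\<close> for \<open>k > 2\<close> and infinite otherwise.\<close>

section \<open>Standard Gaussian measures\<close>

text \<open>One definition for all Euclidean spaces: it serves for vectors, for matrices, whose
  inner product in \<open>real^'p^'n\<close> is the Frobenius one, and for pairs of these, on which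
  independent copies can be mixed.\<close>

definition std_gaussian :: "'a::euclidean_space measure" where
  "std_gaussian = density lborel (\<lambda>x. ennreal (\<Prod>b\<in>Basis. std_normal_density (x \<bullet> b)))"

lemma sets_std_gaussian [simp, measurable_cong]: "sets std_gaussian = sets borel"
  by (simp add: std_gaussian_def)

lemma space_std_gaussian [simp]: "space std_gaussian = UNIV"
  by (simp add: std_gaussian_def)

text \<open>Rotation invariance rests on this form: the density depends on \<open>x\<close> through
  its norm only.\<close>

lemma prod_std_normal_density_eq:
  fixes x :: "'a::euclidean_space"
  shows "(\<Prod>b\<in>Basis. std_normal_density (x \<bullet> b))
       = (1 / sqrt (2 * pi)) ^ DIM('a) * exp (- (norm x)\<^sup>2 / 2)"
proof -
  have "(norm x)\<^sup>2 = (\<Sum>b\<in>Basis. (x \<bullet> b)\<^sup>2)"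
    by (subst power2_norm_eq_inner, subst euclidean_inner) (simp add: power2_eq_square)
  then show ?thesis
    by (simp only: std_normal_density_def prod.distrib prod_constant
        exp_sum[OF finite_Basis, symmetric])
       (simp add: sum_divide_distrib sum_negf)
qed

lemma nn_integral_std_normal_density:
  "(\<integral>\<^sup>+x. ennreal (std_normal_density x) \<partial>lborel) = 1"
  by (subst nn_integral_eq_integral) auto

lemma prob_space_std_gaussian: "prob_space (std_gaussian :: 'a::euclidean_space measure)"
proof
  have "(\<integral>\<^sup>+x. ennreal (\<Prod>b\<in>Basis. std_normal_density (x \<bullet> b)) \<partial>(lborel :: 'a measure))
      = (\<integral>\<^sup>+x. (\<Prod>b\<in>Basis. ennreal (std_normal_density (x \<bullet> b))) \<partial>(lborel :: 'a measure))"
    by (simp add: prod_ennreal)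
  also have "\<dots> = 1"
    by (subst nn_integral_lborel_prod) (auto simp: nn_integral_std_normal_density)
  finally show "emeasure (std_gaussian :: 'a measure) (space std_gaussian) = 1"
    by (simp add: std_gaussian_def emeasure_density)
qed

interpretation std_gaussian: prob_space "std_gaussian :: 'a::euclidean_space measure"
  by (rule prob_space_std_gaussian)

section \<open>Invariance of Lebesgue and Gaussian measure under isometries\<close>

lemma nn_integral_lborel_translate:
  fixes t :: "'a::euclidean_space"
  assumes [measurable]: "f \<in> borel_measurable borel"
  shows "(\<integral>\<^sup>+x. f (t + x) \<partial>lborel) = (\<integral>\<^sup>+x. f x \<partial>lborel)"
proof -
  have "(\<integral>\<^sup>+x. f x \<partial>lborel) = (\<integral>\<^sup>+x. f x \<partial>distr lborel borel ((+) t))"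
    by (simp add: lborel_distr_plus)
  then show ?thesis
    by (simp add: nn_integral_distr)
qed

lemma nn_integral_lborel_reflect:
  fixes t :: "'a::euclidean_space"
  assumes [measurable]: "f \<in> borel_measurable borel"
  shows "(\<integral>\<^sup>+x. f (t - x) \<partial>lborel) = (\<integral>\<^sup>+x. f x \<partial>lborel)"
  by (subst (2) lborel_affine[where c="-1" and t=t])
     (simp_all add: nn_integral_density nn_integral_distr)

lemma borel_measurable_orthogonal_transformation [measurable_dest]:
  fixes T :: "'a::euclidean_space \<Rightarrow> 'a"
  shows "orthogonal_transformation T \<Longrightarrow> T \<in> borel \<rightarrow>\<^sub>M borel"
  by (intro borel_measurable_continuous_onI linear_continuous_on linear_linear[THEN iffD2]
      orthogonal_transformation_linear)

text \<open>Uniqueness of Haar measure in disguise: test the translation-invariant functional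
  \<open>f \<mapsto> \<integral> f (T x)\<close> against a rotation-invariant density and swap the order of integration.\<close>

lemma nn_integral_lborel_orthogonal_transformation:
  fixes T :: "'a::euclidean_space \<Rightarrow> 'a"
  assumes T: "orthogonal_transformation T" and f [measurable]: "f \<in> borel_measurable borel"
  shows "(\<integral>\<^sup>+x. f (T x) \<partial>lborel) = (\<integral>\<^sup>+x. f x \<partial>lborel)"
proof -
  have [measurable]: "T \<in> borel \<rightarrow>\<^sub>M borel"
    by (rule borel_measurable_orthogonal_transformation[OF T])
  \<comment> \<open>The test density: of total mass one, and invariant under \<open>T\<close>
    because it depends on the norm only.\<close>
  define g :: "'a \<Rightarrow> ennreal" where "g = (\<lambda>x. ennreal (\<Prod>b\<in>Basis. std_normal_density (x \<bullet> b)))"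
  have [measurable]: "g \<in> borel_measurable borel" unfolding g_def by measurable
  have g_inv: "g (T x) = g x" for x
    using T by (simp add: g_def prod_std_normal_density_eq orthogonal_transformation_norm)
  have g_int: "(\<integral>\<^sup>+x. g x \<partial>lborel) = 1"
    using std_gaussian.emeasure_space_1[where 'a='a]
    by (simp add: std_gaussian_def emeasure_density g_def)
  obtain T' where T': "\<And>x. T (T' x) = x"
    using orthogonal_transformation_surj[OF T] by (metis surj_def)
  have lin: "T (x - y) = T x - T y" for x y
    using T by (simp add: linear_diff orthogonal_transformation_linear)
  have "(\<integral>\<^sup>+x. f (T x) \<partial>lborel) = (\<integral>\<^sup>+x. f (T x) * (\<integral>\<^sup>+y. g (T x + y) \<partial>lborel) \<partial>lborel)"
    by (simp add: nn_integral_lborel_translate[of g] g_int)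
  also have "\<dots> = (\<integral>\<^sup>+x. (\<integral>\<^sup>+y. f (T x) * g (T x + y) \<partial>lborel) \<partial>lborel)"
    by (simp add: nn_integral_cmult)
  also have "\<dots> = (\<integral>\<^sup>+y. (\<integral>\<^sup>+x. f (T x) * g (T x + y) \<partial>lborel) \<partial>lborel)"
    by (rule lborel_pair.Fubini') measurable
  also have "\<dots> = (\<integral>\<^sup>+y. (\<integral>\<^sup>+x. f (T x - y) * g (T x) \<partial>lborel) \<partial>lborel)"
  proof (rule nn_integral_cong)
    fix y
    show "(\<integral>\<^sup>+x. f (T x) * g (T x + y) \<partial>lborel) = (\<integral>\<^sup>+x. f (T x - y) * g (T x) \<partial>lborel)"
      \<comment> \<open>Since \<open>T' y\<close> is a preimage of \<open>y\<close>, shifting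
        \<open>x\<close> by \<open>- T' y\<close> turns \<open>T x\<close> into
        \<open>T x - y\<close>; this moves \<open>y\<close> from the argument of \<open>g\<close> to
        that of \<open>f\<close>.\<close>
      by (subst nn_integral_lborel_translate[of _ "- T' y", symmetric])
         (simp_all add: lin T' mult.commute)
  qed
  also have "\<dots> = (\<integral>\<^sup>+x. (\<integral>\<^sup>+y. f (T x - y) * g (T x) \<partial>lborel) \<partial>lborel)"
    by (rule lborel_pair.Fubini') measurable
  also have "\<dots> = (\<integral>\<^sup>+x. (\<integral>\<^sup>+y. f y \<partial>lborel) * g x \<partial>lborel)"
    by (simp add: nn_integral_multc nn_integral_lborel_reflect g_inv)
  also have "\<dots> = (\<integral>\<^sup>+y. f y \<partial>lborel)"
    by (simp add: nn_integral_cmult g_int)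
  finally show ?thesis .
qed

lemma nn_integral_std_gaussian:
  assumes [measurable]: "f \<in> borel_measurable borel"
  shows "(\<integral>\<^sup>+x. f x \<partial>std_gaussian)
       = (\<integral>\<^sup>+x. (\<Prod>b\<in>Basis. ennreal (std_normal_density (x \<bullet> b))) * f x \<partial>lborel)"
  unfolding std_gaussian_def by (subst nn_integral_density) (auto simp: prod_ennreal)

lemma nn_integral_std_gaussian_orthogonal_transformation:
  fixes T :: "'a::euclidean_space \<Rightarrow> 'a"
  assumes T: "orthogonal_transformation T" and f [measurable]: "f \<in> borel_measurable borel"
  shows "(\<integral>\<^sup>+x. f (T x) \<partial>std_gaussian) = (\<integral>\<^sup>+x. f x \<partial>std_gaussian)"
proof -
  have [measurable]: "T \<in> borel \<rightarrow>\<^sub>M borel"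
    by (rule borel_measurable_orthogonal_transformation[OF T])
  have "(\<Prod>b\<in>Basis. ennreal (std_normal_density (x \<bullet> b)))
      = (\<Prod>b\<in>Basis. ennreal (std_normal_density (T x \<bullet> b)))" for x
    using T by (simp add: prod_ennreal prod_std_normal_density_eq orthogonal_transformation_norm)
  then show ?thesis
    using nn_integral_lborel_orthogonal_transformation[OF T,
        of "\<lambda>x. (\<Prod>b\<in>Basis. ennreal (std_normal_density (x \<bullet> b))) * f x"]
    by (simp add: nn_integral_std_gaussian)
qed

lemma AE_std_gaussian_orthogonal_transformation:
  fixes T :: "'a::euclidean_space \<Rightarrow> 'a"
  assumes T: "orthogonal_transformation T" and P [measurable]: "Measurable.pred borel P"
    and AE: "AE x in std_gaussian. P x"
  shows "AE x in std_gaussian. P (T x)"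
proof -
  have [measurable]: "T \<in> borel \<rightarrow>\<^sub>M borel"
    by (rule borel_measurable_orthogonal_transformation[OF T])
  have "(\<integral>\<^sup>+x. indicator {x. \<not> P x} (T x) \<partial>std_gaussian)
      = (\<integral>\<^sup>+x. indicator {x. \<not> P x} x \<partial>std_gaussian)"
    by (rule nn_integral_std_gaussian_orthogonal_transformation[OF T]) measurable
  also have "\<dots> = 0"
    using AE by (subst nn_integral_0_iff_AE) (auto simp: indicator_eq_0_iff)
  finally show ?thesis
    by (subst (asm) nn_integral_0_iff_AE) (auto simp: indicator_eq_0_iff)
qed

text \<open>The squared norm of a pair is the sum of the squared norms, so the densities multiply.
  Two independent standard Gaussian vectors thus form a single one, to which orthogonal maps of the
  product space apply.\<close>

lemma std_gaussian_prod:
  "(std_gaussian :: 'a::euclidean_space measure) \<Otimes>\<^sub>M (std_gaussian :: 'b::euclidean_space measure)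
   = std_gaussian"
proof -
  let ?p = "\<lambda>x::'a. ennreal (\<Prod>b\<in>Basis. std_normal_density (x \<bullet> b))"
  let ?q = "\<lambda>x::'b. ennreal (\<Prod>b\<in>Basis. std_normal_density (x \<bullet> b))"
  have "sigma_finite_measure (density lborel ?q)"
    using std_gaussian.sigma_finite_measure_axioms[where 'a='b] by (simp add: std_gaussian_def)
  then have "std_gaussian \<Otimes>\<^sub>M std_gaussian
    = density (lborel \<Otimes>\<^sub>M lborel) (\<lambda>(x, y). ?p x * ?q y)"
    unfolding std_gaussian_def
    by (intro pair_measure_density) (auto intro: lborel.sigma_finite_measure_axioms)
  also have "\<dots> = std_gaussian"
    unfolding std_gaussian_def lborel_prod
    by (intro arg_cong[where f="density lborel"] ext)
       (auto simp: prod_std_normal_density_eq power_add norm_Pair algebra_simps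
          ennreal_mult[symmetric] exp_add[symmetric] diff_divide_distrib)
  finally show ?thesis .
qed

lemma nn_integral_std_gaussian_prod:
  fixes f :: "'a::euclidean_space \<times> 'b::euclidean_space \<Rightarrow> ennreal"
  assumes [measurable]: "f \<in> borel_measurable borel"
  shows "(\<integral>\<^sup>+x. (\<integral>\<^sup>+y. f (x, y) \<partial>std_gaussian) \<partial>std_gaussian) = (\<integral>\<^sup>+z. f z \<partial>std_gaussian)"
  by (subst std_gaussian_prod[symmetric]) (rule std_gaussian.nn_integral_fst, subst measurable_cong_sets[OF sets_pair_measure_cong refl],
      auto simp: borel_prod)

text \<open>Extend \<open>E\<close> to an orthogonal basis, normalise the added vectors and send the
  standard basis to the result, matching a subset \<open>D\<close> as large as \<open>E\<close> with
  \<open>E\<close> itself. Up to rotation, an orthonormal family is a set of coordinate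
  axes.\<close>

lemma orthonormal_imp_orthogonal_transformation:
  fixes E :: "'a::euclidean_space set"
  assumes orth: "pairwise orthogonal E" and one: "\<And>e. e \<in> E \<Longrightarrow> norm e = 1"
  obtains T :: "'a \<Rightarrow> 'a" and D where "orthogonal_transformation T" "D \<subseteq> Basis" "bij_betw T D E"
proof -
  have indE: "independent E"
    using orth one by (intro pairwise_orthogonal_independent) (auto, metis norm_zero zero_neq_one)
  then have finE: "finite E" and cardE: "card E \<le> DIM('a)"
    using independent_bound by auto
  obtain U where U: "U \<inter> insert 0 E = {}" "pairwise orthogonal (E \<union> U)"
      "span (E \<union> U) = span (E \<union> UNIV)"
    by (rule orthogonal_extension_strong[OF orth])
  have indEU: "independent (E \<union> U)"
    using U one by (intro pairwise_orthogonal_independent) (auto, metis norm_zero zero_neq_one)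
  have "card (E \<union> U) = DIM('a)"
    using U(3) indEU by (metis dim_UNIV dim_span dim_eq_card_independent sup_top_right span_UNIV)
  have finU: "finite U" using indEU independent_bound by auto
  let ?s = "\<lambda>x. x /\<^sub>R norm x"
  obtain D :: "'a set" where D: "D \<subseteq> Basis" "card D = card E"
    using cardE by (metis obtain_subset_with_card_n)
  have finD: "finite D" using D finite_subset finite_Basis by blast
  obtain h1 where h1: "bij_betw h1 D E"
    using D finE finD by (metis finite_same_card_bij)
  have "card (Basis - D) = card U"
    using \<open>card (E \<union> U) = DIM('a)\<close> D U finE finU finD by (subst card_Diff_subset) (auto simp: card_Un_disjoint Int_commute)
  then obtain h2 where h2: "bij_betw h2 (Basis - D) U"
    using finU by (metis finite_same_card_bij finite_Basis finite_Diff)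
  define h where "h b = (if b \<in> D then h1 b else ?s (h2 b))" for b
  have hh: "h b \<bullet> h c = (if b = c then 1 else 0)" if bc: "b \<in> Basis" "c \<in> Basis" for b c
  proof -
    \<comment> \<open>\<open>k\<close> is \<open>h\<close> before normalisation. It is injective on
      the basis and takes values in the orthogonal set \<open>E \<union> U\<close>, so distinct
      indices give orthogonal vectors.\<close>
    define k where "k b = (if b \<in> D then h1 b else h2 b)" for b
    have inE: "b \<in> D \<Longrightarrow> h1 b \<in> E" for b using h1 by (auto simp: bij_betw_def)
    have inU: "b \<in> Basis \<Longrightarrow> b \<notin> D \<Longrightarrow> h2 b \<in> U" for b using h2 by (auto simp: bij_betw_def)
    have k_in: "k b \<in> E \<union> U" if "b \<in> Basis" for b
      using that inE inU by (auto simp: k_def)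
    have k_nz: "k b \<noteq> 0" if "b \<in> Basis" for b
      using that inE[of b] inU[of b] U(1) one[of "h1 b"] by (cases "b \<in> D") (auto simp: k_def)
    have h_k: "h b = k b /\<^sub>R norm (k b)" for b
      using inE[of b] one[of "h1 b"] by (auto simp: h_def k_def)
    have k_inj: "k b \<noteq> k c" if "b \<noteq> c"
    proof -
      consider "b \<in> D" "c \<in> D" | "b \<notin> D" "c \<notin> D" | "b \<in> D" "c \<notin> D" | "b \<notin> D" "c \<in> D"
        by blast
      then show ?thesis
      proof cases
        case 1
        then show ?thesis
          using inj_on_contraD[OF bij_betw_imp_inj_on[OF h1] that] by (simp add: k_def)
      next
        case 2
        then show ?thesis
          using inj_on_contraD[OF bij_betw_imp_inj_on[OF h2] that] bc by (simp add: k_def)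
      next
        case 3
        then have "k b \<in> E" "k c \<in> U" using inE inU bc by (simp_all add: k_def)
        then show ?thesis using U(1) by auto
      next
        case 4
        then have "k c \<in> E" "k b \<in> U" using inE inU bc by (simp_all add: k_def)
        then show ?thesis using U(1) by auto
      qed
    qed
    show ?thesis
    proof (cases "b = c")
      case True
      then show ?thesis
        using k_nz[OF bc(1)] by (simp add: h_k dot_square_norm power2_eq_square)
    next
      case False
      then have "orthogonal (k b) (k c)"
        using U(2) k_in bc k_inj by (metis pairwise_def)
      then show ?thesis using False by (simp add: h_k orthogonal_def)
    qed
  qed
  define T where "T x = (\<Sum>b\<in>Basis. (x \<bullet> b) *\<^sub>R h b)" for x
  have lin: "linear T"
    unfolding T_def by (intro linear_compose_sum ballI linear_scaleR_left
       linearI) (auto simp: inner_add_left algebra_simps)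
  have "T x \<bullet> T y = x \<bullet> y" for x y
  proof -
    have "T x \<bullet> T y = (\<Sum>b\<in>Basis. \<Sum>c\<in>Basis. (x \<bullet> b) * (y \<bullet> c) * (if b = c then 1 else 0))"
      unfolding T_def inner_sum_left inner_sum_right by (intro sum.cong refl) (simp add: hh)
    also have "\<dots> = x \<bullet> y"
      by (subst euclidean_inner) (simp add: if_distrib cong: if_cong)
    finally show ?thesis .
  qed
  then have "orthogonal_transformation T"
    using lin by (simp add: orthogonal_transformation_def)
  moreover have Tb: "T b = h b" if "b \<in> Basis" for b
    using that by (simp add: T_def inner_Basis if_distrib[of "\<lambda>r. r *\<^sub>R _"] cong: if_cong)
  have "bij_betw T D E"
    using h1 by (rule bij_betw_cong[THEN iffD1, rotated]) (use D Tb in \<open>auto simp: h_def\<close>)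
  ultimately show ?thesis using that D by blast
qed

text \<open>After a rotation the family consists of coordinate axes and the density factors;
  coordinates outside \<open>D\<close> integrate to 1. In effect, the components along an
  orthonormal family are independent standard normal variables.\<close>

lemma nn_integral_std_gaussian_orthonormal:
  fixes E :: "'a::euclidean_space set" and f :: "real \<Rightarrow> ennreal"
  assumes orth: "pairwise orthogonal E" and one: "\<And>e. e \<in> E \<Longrightarrow> norm e = 1"
    and f [measurable]: "f \<in> borel_measurable borel"
  shows "(\<integral>\<^sup>+x. (\<Prod>e\<in>E. f (x \<bullet> e)) \<partial>std_gaussian)
       = (\<integral>\<^sup>+z. ennreal (std_normal_density z) * f z \<partial>lborel) ^ card E"
proof -
  obtain T :: "'a \<Rightarrow> 'a" and D where T: "orthogonal_transformation T" and D: "D \<subseteq> Basis" and bij: "bij_betw T D E"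
    using orthonormal_imp_orthogonal_transformation[OF orth one] by blast
  let ?n = "\<lambda>z. ennreal (std_normal_density z)"
  have "(\<integral>\<^sup>+x. (\<Prod>e\<in>E. f (x \<bullet> e)) \<partial>std_gaussian)
      = (\<integral>\<^sup>+x. (\<Prod>e\<in>E. f (T x \<bullet> e)) \<partial>std_gaussian)"
    by (rule nn_integral_std_gaussian_orthogonal_transformation[OF T, symmetric]) measurable
  also have "(\<lambda>x. \<Prod>e\<in>E. f (T x \<bullet> e)) = (\<lambda>x. \<Prod>b\<in>D. f (x \<bullet> b))"
  proof
    fix x
    have "(\<Prod>e\<in>E. f (T x \<bullet> e)) = (\<Prod>b\<in>D. f (T x \<bullet> T b))"
      by (rule prod.reindex_bij_betw[OF bij, symmetric])
    then show "(\<Prod>e\<in>E. f (T x \<bullet> e)) = (\<Prod>b\<in>D. f (x \<bullet> b))"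
      using T by (simp add: orthogonal_transformation_def)
  qed
  also have "(\<integral>\<^sup>+x. (\<Prod>b\<in>D. f (x \<bullet> b)) \<partial>std_gaussian)
      = (\<integral>\<^sup>+x. (\<Prod>b\<in>Basis. ?n (x \<bullet> b) * (if b \<in> D then f (x \<bullet> b) else 1)) \<partial>lborel)"
    using D by (subst nn_integral_std_gaussian)
      (auto simp: prod.distrib prod.If_cases Int_absorb1 intro!: nn_integral_cong)
  also have "\<dots> = (\<Prod>b\<in>Basis. \<integral>\<^sup>+z. ?n z * (if b \<in> D then f z else 1) \<partial>lborel)"
    by (rule nn_integral_lborel_prod[where f="\<lambda>b z. ?n z * (if b \<in> D then f z else 1)"]) auto
  also have "\<dots> = (\<Prod>b\<in>Basis. if b \<in> D then (\<integral>\<^sup>+z. ?n z * f z \<partial>lborel) else 1)"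
    by (intro prod.cong refl) (simp add: nn_integral_std_normal_density)
  also have "\<dots> = (\<integral>\<^sup>+z. ?n z * f z \<partial>lborel) ^ card E"
    using D bij by (simp add: prod.If_cases Int_absorb1 bij_betw_same_card)
  finally show ?thesis .
qed

section \<open>Mean of the reciprocal of a chi-squared variable\<close>

lemma nn_integral_std_normal_exp_square:
  assumes "0 \<le> t"
  shows "(\<integral>\<^sup>+z. ennreal (std_normal_density z) * ennreal (exp (- t * z\<^sup>2)) \<partial>lborel)
       = ennreal (1 / sqrt (1 + 2 * t))"
proof -
  \<comment> \<open>Rescaling by \<open>?s\<close> absorbs the exponential factor, since half of
    \<open>(?s * z)^2\<close> is \<open>z^2 / 2 + t * z^2\<close>. The value is the Laplace
    transform of a chi-squared variable with one degree of freedom.\<close>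
  let ?s = "sqrt (1 + 2 * t)"
  have s: "0 < ?s" using assms by simp
  have "(\<integral>\<^sup>+z. ennreal (std_normal_density z) \<partial>lborel)
      = ennreal \<bar>?s\<bar> * (\<integral>\<^sup>+z. ennreal (std_normal_density (0 + ?s * z)) \<partial>lborel)"
    by (rule nn_integral_real_affine) (use s in auto)
  moreover have "std_normal_density (0 + ?s * z) = std_normal_density z * exp (- t * z\<^sup>2)" for z
    using assms by (simp add: std_normal_density_def power_mult_distrib exp_add[symmetric] field_simps)
  ultimately have "1 = ennreal ?s * (\<integral>\<^sup>+z. ennreal (std_normal_density z) * ennreal (exp (- t * z\<^sup>2)) \<partial>lborel)"
    using assms by (simp add: nn_integral_std_normal_density ennreal_mult)
  then have "ennreal (1 / ?s) * 1 = ennreal (1 / ?s) * ennreal ?s * (\<integral>\<^sup>+z. ennreal (std_normal_density z) * ennreal (exp (- t * z\<^sup>2)) \<partial>lborel)"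
    by (simp add: mult.assoc)
  then show ?thesis
    using s by (simp add: ennreal_mult[symmetric])
qed

lemma ennreal_eq_infinityI:
  assumes "\<And>n. ennreal (real n) \<le> x"
  shows "x = \<infinity>"
proof (rule ccontr)
  assume "x \<noteq> \<infinity>"
  then have "x < top" by (simp add: top.not_eq_extremum)
  then obtain n where "x < of_nat n" using ennreal_Ex_less_of_nat by blast
  then show False using assms[of n] by (simp add: ennreal_of_nat_eq_real_of_nat leD)
qed

text \<open>At \<open>s = 0\<close> both sides are infinite, because \<open>inverse 0\<close> is
  infinite in \<open>ennreal\<close>; a sum of squares that may vanish can therefore be inserted for
  \<open>s\<close>.\<close>

lemma nn_integral_exp_atLeast_0:
  assumes "0 \<le> s"
  shows "(\<integral>\<^sup>+t. ennreal (exp (- t * s)) * indicator {0..} t \<partial>lborel) = inverse (ennreal s)"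
proof (cases "s = 0")
  case True
  have "(\<integral>\<^sup>+t. indicator {0::real..} t \<partial>lborel) = \<infinity>"
  proof -
    have "ennreal (real n) \<le> emeasure lborel {0::real..}" for n
    proof -
      have "ennreal (real n) = emeasure lborel {0..real n}" by simp
      also have "\<dots> \<le> emeasure lborel {0::real..}" by (intro emeasure_mono) auto
      finally show ?thesis .
    qed
    then have "emeasure lborel {0::real..} = \<infinity>"
      by (rule ennreal_eq_infinityI)
    then show ?thesis by simp
  qed
  then show ?thesis using True by simp
next
  case False
  then have s: "0 < s" using assms by simp
  have "(\<integral>\<^sup>+t. ennreal (exp (- t * s)) * indicator {0..} t \<partial>lborel) = ennreal (0 - (- exp (- 0 * s) / s))"
  proof (rule nn_integral_FTC_atLeast)
    show "((\<lambda>t. - exp (- t * s) / s) \<longlongrightarrow> 0) at_top"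
      using s by real_asymp
  qed (use s in \<open>auto intro!: derivative_eq_intros\<close>)
  then show ?thesis
    using s by (simp add: inverse_ennreal inverse_eq_divide)
qed

text \<open>For \<open>2 < k\<close> there is an antiderivative with the negative exponent
  \<open>1 - k / 2\<close>, which vanishes at infinity. For smaller \<open>k\<close> the integrand
  dominates \<open>1 / (1 + 2 * t)\<close>, because its base is at most 1, and the integral diverges
  logarithmically.\<close>

lemma nn_integral_inverse_powr:
  "(\<integral>\<^sup>+t. ennreal ((1 / sqrt (1 + 2 * t)) ^ k) * indicator {0..} t \<partial>lborel)
   = (if 2 < k then ennreal (1 / (real k - 2)) else \<infinity>)"
proof (cases "2 < k")
  case True
  have eq: "(1 / sqrt (1 + 2 * t)) ^ k = (1 + 2 * t) powr (- real k / 2)" if "0 \<le> t" for t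
    using that by (simp add: powr_half_sqrt[symmetric] power_divide powr_minus_divide
        powr_realpow[symmetric] powr_powr mult.commute)
  have "(\<integral>\<^sup>+t. ennreal ((1 / sqrt (1 + 2 * t)) ^ k) * indicator {0..} t \<partial>lborel)
      = (\<integral>\<^sup>+t. ennreal ((1 + 2 * t) powr (- real k / 2)) * indicator {0..} t \<partial>lborel)"
    by (intro nn_integral_cong) (auto simp: eq split: split_indicator)
  also have "\<dots> = ennreal (0 - (1 + 2 * 0) powr (1 - real k / 2) / (2 - real k))"
  proof (rule nn_integral_FTC_atLeast)
    show "((\<lambda>t. (1 + 2 * t) powr (1 - real k / 2) / (2 - real k)) \<longlongrightarrow> 0) at_top"
    proof -
      have "1 - real k / 2 < 0" using True by simp
      then have "((\<lambda>t::real. (1 + 2 * t) powr (1 - real k / 2)) \<longlongrightarrow> 0) at_top"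
        by (intro tendsto_neg_powr) (auto, real_asymp)
      then show ?thesis using tendsto_divide_zero by blast
    qed
    show "((\<lambda>t. (1 + 2 * t) powr (1 - real k / 2) / (2 - real k)) has_real_derivative
        (1 + 2 * t) powr (- real k / 2)) (at t)" if "0 \<le> t" for t
    proof -
      have "((1 - real k / 2) * (1 + 2 * t) powr (1 - real k / 2 - 1) * 2) / (2 - real k)
          = (1 + 2 * t) powr (- real k / 2)"
        using True by (simp add: field_simps)
      then show ?thesis
        using that by (auto intro!: derivative_eq_intros)
    qed
  qed auto
  finally show ?thesis using True by (simp add: field_simps)
next
  case False
  have le: "1 / (1 + 2 * t) \<le> (1 / sqrt (1 + 2 * t)) ^ k" if "0 \<le> t" for t
  proof -
    have "(1 / sqrt (1 + 2 * t)) ^ 2 \<le> (1 / sqrt (1 + 2 * t)) ^ k"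
      using False that by (intro power_decreasing) auto
    then show ?thesis using that by (simp add: power_divide)
  qed
  have "ennreal (real n) \<le> (\<integral>\<^sup>+t. ennreal ((1 / sqrt (1 + 2 * t)) ^ k) * indicator {0..} t \<partial>lborel)" for n
  proof -
    \<comment> \<open>Chosen so that \<open>ln (1 + 2 * ?b) / 2\<close> is exactly
      \<open>n\<close>.\<close>
    let ?b = "(exp (2 * real n) - 1) / 2"
    have "(\<integral>\<^sup>+t. ennreal (1 / (1 + 2 * t)) * indicator {0..?b} t \<partial>lborel)
        = ennreal (ln (1 + 2 * ?b) / 2 - ln (1 + 2 * 0) / 2)"
      by (rule nn_integral_FTC_Icc) (auto intro!: derivative_eq_intros simp: divide_simps)
    moreover have "1 + 2 * ?b = exp (2 * real n)"
      by (simp add: field_simps)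
    ultimately have "ennreal (real n) = (\<integral>\<^sup>+t. ennreal (1 / (1 + 2 * t)) * indicator {0..?b} t \<partial>lborel)"
      by (simp only: ln_exp) simp
    also have "\<dots> \<le> (\<integral>\<^sup>+t. ennreal ((1 / sqrt (1 + 2 * t)) ^ k) * indicator {0..} t \<partial>lborel)"
      by (intro nn_integral_mono) (auto simp del: power_divide intro!: le split: split_indicator)
    finally show ?thesis .
  qed
  then have "(\<integral>\<^sup>+t. ennreal ((1 / sqrt (1 + 2 * t)) ^ k) * indicator {0..} t \<partial>lborel) = \<infinity>"
    by (rule ennreal_eq_infinityI)
  then show ?thesis
    by (simp only: False if_False)
qed

text \<open>By Tonelli from \<open>1 / s = \<integral>\<^sub>0\<^sup>\<infinity> exp (- t s) dt\<close>; this covers the divergent cases as well.\<close>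

lemma nn_integral_std_gaussian_inverse_chi_square:
  fixes E :: "'a::euclidean_space set"
  assumes orth: "pairwise orthogonal E" and one: "\<And>e. e \<in> E \<Longrightarrow> norm e = 1"
  shows "(\<integral>\<^sup>+x. inverse (ennreal (\<Sum>e\<in>E. (x \<bullet> e)\<^sup>2)) \<partial>std_gaussian)
       = (if 2 < card E then ennreal (1 / (real (card E) - 2)) else \<infinity>)"
proof -
  have finE: "finite E"
    using orth by (rule pairwise_orthogonal_imp_finite)
  have "(\<integral>\<^sup>+x. inverse (ennreal (\<Sum>e\<in>E. (x \<bullet> e)\<^sup>2)) \<partial>std_gaussian)
      = (\<integral>\<^sup>+x. (\<integral>\<^sup>+t. ennreal (exp (- t * (\<Sum>e\<in>E. (x \<bullet> e)\<^sup>2))) * indicator {0..} t \<partial>lborel) \<partial>std_gaussian)"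
    by (subst nn_integral_exp_atLeast_0) (auto simp: sum_nonneg)
  also have "\<dots> = (\<integral>\<^sup>+t. (\<integral>\<^sup>+x. ennreal (exp (- t * (\<Sum>e\<in>E. (x \<bullet> e)\<^sup>2))) * indicator {0..} t \<partial>std_gaussian) \<partial>lborel)"
  proof (rule pair_sigma_finite.Fubini'[symmetric])
    show "pair_sigma_finite (std_gaussian :: 'a measure) lborel"
      by (intro pair_sigma_finite.intro lborel.sigma_finite_measure_axioms
          std_gaussian.sigma_finite_measure_axioms)
  qed measurable
  also have "\<dots> = (\<integral>\<^sup>+t. ennreal ((1 / sqrt (1 + 2 * t)) ^ card E) * indicator {0..} t \<partial>lborel)"
  proof (rule nn_integral_cong)
    fix t :: real
    show "(\<integral>\<^sup>+x. ennreal (exp (- t * (\<Sum>e\<in>E. (x \<bullet> e)\<^sup>2))) * indicator {0..} t \<partial>std_gaussian)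
        = ennreal ((1 / sqrt (1 + 2 * t)) ^ card E) * indicator {0..} t"
    proof (cases "0 \<le> t")
      case True
      \<comment> \<open>The exponential of the sum factors over the family, so the mean is a product
        of \<open>card E\<close> equal one-dimensional Laplace transforms.\<close>
      have "ennreal (exp (- t * (\<Sum>e\<in>E. (x \<bullet> e)\<^sup>2))) = (\<Prod>e\<in>E. ennreal (exp (- t * (x \<bullet> e)\<^sup>2)))" for x :: 'a
        using finE by (simp add: prod_ennreal exp_sum[symmetric] sum_distrib_left sum_negf)
      then have "(\<integral>\<^sup>+x. ennreal (exp (- t * (\<Sum>e\<in>E. (x \<bullet> e)\<^sup>2))) \<partial>std_gaussian)
        = ennreal (1 / sqrt (1 + 2 * t)) ^ card E"
        using nn_integral_std_gaussian_orthonormal[OF orth one, of "\<lambda>z. ennreal (exp (- t * z\<^sup>2))"]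
          nn_integral_std_normal_exp_square[OF True] by simp
      then show ?thesis using True by (simp add: ennreal_power[symmetric])
    qed simp
  qed
  also have "\<dots> = (if 2 < card E then ennreal (1 / (real (card E) - 2)) else \<infinity>)"
    by (rule nn_integral_inverse_powr)
  finally show ?thesis .
qed

text \<open>Along the unit vector in direction \<open>e\<close> this is a one-dimensional second
  moment; after expanding the square, the cross term is an odd moment and vanishes.\<close>

lemma nn_integral_std_gaussian_inner_square:
  fixes e :: "'a::euclidean_space"
  shows "(\<integral>\<^sup>+x. ennreal ((x \<bullet> e + c)\<^sup>2) \<partial>std_gaussian) = ennreal ((norm e)\<^sup>2 + c\<^sup>2)"
proof (cases "e = 0")
  case True
  then show ?thesis
    by (simp add: std_gaussian.emeasure_space_1[where 'a='a, simplified])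
next
  case False
  let ?u = "e /\<^sub>R norm e"
  have eq: "x \<bullet> e = norm e * (x \<bullet> ?u)" for x using False by simp
  have "has_bochner_integral lborel
      (\<lambda>z. (norm e)\<^sup>2 * (std_normal_density z * z ^ (2 * 1)) + 2 * norm e * c * (std_normal_density z * z ^ (2 * 0 + 1))
           + c\<^sup>2 * (std_normal_density z * z ^ (2 * 0)))
      ((norm e)\<^sup>2 * (fact (2 * 1) / (2 ^ 1 * fact 1)) + 2 * norm e * c * 0 + c\<^sup>2 * (fact (2 * 0) / (2 ^ 0 * fact 0)))"
    by (intro has_bochner_integral_add has_bochner_integral_mult_right std_normal_moment_even std_normal_moment_odd)
  then have "has_bochner_integral lborel (\<lambda>z. std_normal_density z * (norm e * z + c)\<^sup>2) ((norm e)\<^sup>2 + c\<^sup>2)"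
    by (simp add: power2_eq_square algebra_simps)
  then have "(\<integral>\<^sup>+z. ennreal (std_normal_density z * (norm e * z + c)\<^sup>2) \<partial>lborel) = ennreal ((norm e)\<^sup>2 + c\<^sup>2)"
    by (simp add: has_bochner_integral_iff nn_integral_eq_integral)
  moreover have "(\<integral>\<^sup>+x. (\<Prod>v\<in>{?u}. ennreal ((norm e * (x \<bullet> v) + c)\<^sup>2)) \<partial>std_gaussian)
      = (\<integral>\<^sup>+z. ennreal (std_normal_density z) * ennreal ((norm e * z + c)\<^sup>2) \<partial>lborel) ^ card {?u}"
    using False by (intro nn_integral_std_gaussian_orthonormal[where f="\<lambda>z. ennreal ((norm e * z + c)\<^sup>2)"]) auto
  ultimately show ?thesis
    using False by (simp add: ennreal_mult mult.assoc[symmetric])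
qed

section \<open>Pseudoinverses and the measurable inverse\<close>

text \<open>The Penrose conditions for rectangular matrices, needed because the estimator turns out
  to be the pseudoinverse of \<open>cols S A\<close>, whereas \<open>mp_pinv\<close> is typed for
  square matrices.\<close>

definition is_pinv :: "real^'p^'n \<Rightarrow> real^'n^'p \<Rightarrow> bool" where
  "is_pinv B W \<longleftrightarrow> B ** W ** B = B \<and> W ** B ** W = W \<and>
     transpose (B ** W) = B ** W \<and> transpose (W ** B) = W ** B"

lemma is_pinvD:
  assumes "is_pinv B W"
  shows "B ** (W ** B) = B" "W ** (B ** W) = W"
    "B ** (W ** (B ** C)) = B ** C" "W ** (B ** (W ** D)) = W ** D"
    "transpose (B ** W) = B ** W" "transpose (W ** B) = W ** B"
  using assms by (simp_all add: is_pinv_def matrix_mul_assoc)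

lemma is_pinv_transpose:
  assumes "is_pinv B W"
  shows "is_pinv (transpose B) (transpose W)"
proof -
  have "transpose (B ** (W ** B)) = transpose B" "transpose (W ** (B ** W)) = transpose W"
    by (simp_all only: is_pinvD(1,2)[OF assms])
  then show ?thesis
    unfolding is_pinv_def
    by (simp add: matrix_transpose_mul[of B "W ** B"] matrix_transpose_mul[of W "B ** W"]
        is_pinvD(5,6)[OF assms] flip: matrix_transpose_mul[of B W] matrix_transpose_mul[of W B])
qed

text \<open>Both products are the orthogonal projection onto the range of \<open>B\<close>.
  Concretely, \<open>B W B W' = B W'\<close>, and transposing reverses the two symmetric factors,
  which leaves \<open>B W\<close>.\<close>

lemma is_pinv_unique_mult:
  assumes W: "is_pinv B W" and W': "is_pinv B W'"
  shows "B ** W = B ** W'"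
proof -
  have "B ** W' = transpose (B ** W ** (B ** W'))"
    by (simp add: is_pinvD[OF W] is_pinvD(5)[OF W'] flip: matrix_mul_assoc)
  also have "\<dots> = B ** W' ** (B ** W)"
    by (simp only: matrix_transpose_mul[of "B ** W"] is_pinvD(5)[OF W] is_pinvD(5)[OF W'])
  also have "\<dots> = B ** W"
    by (simp add: is_pinvD(3)[OF W'] flip: matrix_mul_assoc)
  finally show ?thesis by simp
qed

text \<open>The uniqueness of \<open>B W\<close>, applied to the transposes, gives
  \<open>W B = W' B\<close>; hence \<open>W = W B W = W' B W = W' B W' = W'\<close>.\<close>

lemma is_pinv_unique:
  assumes W: "is_pinv B W" and W': "is_pinv B W'"
  shows "W = W'"
proof -
  have "transpose B ** transpose W = transpose B ** transpose W'"
    using W W' by (intro is_pinv_unique_mult is_pinv_transpose)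
  then have "W ** B = W' ** B"
    by (simp only: is_pinvD(6)[OF W] is_pinvD(6)[OF W'] flip: matrix_transpose_mul)
  then have "W ** (B ** W) = W' ** (B ** W)"
    by (simp add: matrix_mul_assoc)
  also have "\<dots> = W'"
    by (simp only: is_pinv_unique_mult[OF W W'] is_pinvD(2)[OF W'])
  finally show ?thesis
    by (simp only: is_pinvD(2)[OF W])
qed

lemma mp_pinv_eqI:
  assumes "is_pinv M X"
  shows "mp_pinv M = X"
proof -
  have "(THE Y. is_pinv M Y) = X"
    using assms by (rule the_equality) (rule is_pinv_unique[OF _ assms])
  then show ?thesis by (simp only: mp_pinv_def is_pinv_def)
qed

text \<open>Symmetry of \<open>W B\<close> turns the left side into \<open>W B W\<close>. Together
  with \<open>is_pinv_gram\<close> this identifies the estimator, a transpose times the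
  pseudoinverse of the Gram matrix, with the pseudoinverse \<open>W\<close> of
  \<open>B\<close>.\<close>

lemma is_pinv_transpose_mul:
  assumes "is_pinv B W"
  shows "transpose B ** (transpose W ** W) = W"
proof -
  have "transpose B ** (transpose W ** W) = transpose (W ** B) ** W"
    by (simp only: matrix_transpose_mul matrix_mul_assoc)
  also have "\<dots> = W"
    by (simp only: is_pinvD(6)[OF assms]) (simp only: is_pinvD(2)[OF assms] flip: matrix_mul_assoc)
  finally show ?thesis .
qed

text \<open>Both products of the two Gram matrices collapse to \<open>B W\<close>, the orthogonal
  projection onto the range of \<open>B\<close>, and this projection fixes each of them.\<close>

lemma is_pinv_gram:
  assumes "is_pinv B W"
  shows "is_pinv (B ** transpose B) (transpose W ** W)"
proof -
  have 1: "B ** transpose B ** (transpose W ** W) = B ** W"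
    using is_pinv_transpose_mul[OF assms] by (simp only: flip: matrix_mul_assoc)
  have "transpose W ** W ** (B ** transpose B)
      = transpose (B ** transpose B ** (transpose W ** W))"
    by (simp only: matrix_transpose_mul transpose_transpose)
  then have 2: "transpose W ** W ** (B ** transpose B) = B ** W"
    by (simp only: 1 is_pinvD(5)[OF assms])
  have 3: "B ** W ** (transpose W ** W) = transpose W ** W"
  proof -
    have "B ** W ** transpose W = transpose (W ** (B ** W))"
      by (simp only: matrix_transpose_mul[of W "B ** W"] is_pinvD(5)[OF assms])
    then have "B ** W ** transpose W = transpose W"
      by (simp only: is_pinvD(2)[OF assms])
    then show ?thesis by (simp only: matrix_mul_assoc)
  qed
  have 4: "B ** W ** (B ** transpose B) = B ** transpose B"
    by (simp only: is_pinvD(3)[OF assms] flip: matrix_mul_assoc)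
  show ?thesis
    unfolding is_pinv_def by (simp only: 1 2 3 4 is_pinvD(5)[OF assms])
qed

lemma is_pinv_orthogonal_left:
  assumes W: "is_pinv B W" and U: "orthogonal_matrix U"
  shows "is_pinv (U ** B) (W ** transpose U)"
proof -
  have "W ** transpose U ** (U ** B) = W ** (transpose U ** U) ** B"
    by (simp only: matrix_mul_assoc)
  also have "\<dots> = W ** B"
    using U by (simp add: orthogonal_matrix_def)
  finally have 1: "W ** transpose U ** (U ** B) = W ** B" .
  have 2: "U ** B ** (W ** transpose U) ** (U ** B) = U ** B ** (W ** transpose U ** (U ** B))"
    by (simp only: matrix_mul_assoc)
  have 3: "U ** B ** (W ** B) = U ** B" "W ** B ** (W ** transpose U) = W ** transpose U"
    by (simp_all only: is_pinvD[OF W] flip: matrix_mul_assoc)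
  have "transpose (U ** B ** (W ** transpose U)) = U ** transpose (B ** W) ** transpose U"
    by (simp only: matrix_transpose_mul transpose_transpose matrix_mul_assoc)
  then have 4: "transpose (U ** B ** (W ** transpose U)) = U ** B ** (W ** transpose U)"
    by (simp only: is_pinvD(5)[OF W] matrix_mul_assoc)
  show ?thesis
    unfolding is_pinv_def by (simp only: 1 2 3 4 is_pinvD(6)[OF W])
qed

lemma is_pinv_orthogonal_right:
  assumes "is_pinv B W" and "orthogonal_matrix U"
  shows "is_pinv (B ** U) (transpose U ** W)"
proof -
  have "is_pinv (transpose U ** transpose B) (transpose W ** transpose (transpose U))"
    using assms by (intro is_pinv_orthogonal_left is_pinv_transpose)
      (auto simp: orthogonal_matrix_transpose)
  from is_pinv_transpose[OF this] show ?thesis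
    by (simp add: matrix_transpose_mul)
qed

text \<open>Pythagoras: \<open>W B\<close> is the orthogonal projection onto the range of
  \<open>W\<close>, so \<open>x - W B x\<close> is orthogonal to every \<open>W u\<close>.\<close>

lemma norm_residual_pinv:
  fixes x :: "real^'p" and u :: "real^'n"
  assumes "is_pinv B W"
  shows "(norm (x - W *v (B *v x + u)))\<^sup>2 = (norm (x - (W ** B) *v x))\<^sup>2 + (norm (W *v u))\<^sup>2"
proof -
  let ?P = "W ** B"
  have "(?P *v x) \<bullet> (W *v u) = x \<bullet> (transpose ?P *v (W *v u))"
    by (metis dot_lmul_matrix inner_commute vector_transpose_matrix transpose_transpose)
  also have "\<dots> = x \<bullet> (W *v u)"
    using assms by (simp add: is_pinv_def matrix_vector_mul_assoc)
  finally have "(x - ?P *v x) \<bullet> (W *v u) = 0"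
    by (simp add: inner_diff_left)
  moreover have "x - W *v (B *v x + u) = (x - ?P *v x) - W *v u"
    by (simp add: matrix_vector_right_distrib matrix_vector_mul_assoc)
  moreover have "(norm (a - b))\<^sup>2 = (norm a)\<^sup>2 + (norm b)\<^sup>2" if "a \<bullet> b = 0" for a b :: "real^'p"
    using that by (simp add: power2_norm_eq_inner inner_diff_left inner_diff_right inner_commute)
  ultimately show ?thesis by metis
qed

text \<open>The complementary map \<open>1 - P\<close> is also an orthogonal projection, so the
  squared norm of its column is its diagonal entry; summing over \<open>k\<close> leads to a
  trace.\<close>

lemma norm_projection_residual_axis:
  fixes P :: "real^'p^'p"
  assumes "transpose P = P" "P ** P = P"
  shows "(norm (axis k 1 - P *v axis k 1))\<^sup>2 = 1 - P $ k $ k"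
proof -
  have "(P *v axis k 1) \<bullet> (P *v axis k 1) = axis k 1 \<bullet> (transpose P *v (P *v axis k 1))"
    by (metis dot_lmul_matrix inner_commute vector_transpose_matrix transpose_transpose)
  also have "\<dots> = axis k 1 \<bullet> (P *v axis k 1)"
    using assms by (simp add: matrix_vector_mul_assoc)
  finally have "(P *v axis k 1) \<bullet> (P *v axis k 1) = axis k 1 \<bullet> (P *v axis k 1)" .
  moreover have "axis k 1 \<bullet> (P *v axis k 1) = P $ k $ k"
    by (simp add: inner_axis' matrix_vector_mult_basis column_def)
  ultimately show ?thesis
    by (simp add: power2_norm_eq_inner inner_diff_left inner_diff_right inner_commute inner_axis_axis)
qed

lemma sum_norm_matrix_axis:
  fixes W :: "real^'n^'p"
  shows "(\<Sum>i\<in>UNIV. (norm (W *v axis i 1))\<^sup>2) = trace (transpose W ** W)"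
  by (simp add: trace_def matrix_matrix_mult_def transpose_def power2_norm_eq_inner inner_vec_def
      matrix_vector_mult_basis column_def)

section \<open>Householder reflections\<close>

definition householder :: "real^'n \<Rightarrow> real^'n^'n" where
  "householder d = mat 1 - (\<chi> i j. 2 / (d \<bullet> d) * d $ i * d $ j)"

lemma householder_mult: "householder d *v x = x - (2 / (d \<bullet> d) * (d \<bullet> x)) *\<^sub>R d"
  by (simp add: householder_def matrix_vector_mult_diff_rdistrib vec_eq_iff)
     (simp add: matrix_vector_mult_def inner_vec_def sum_distrib_left sum_distrib_right
      sum_divide_distrib mult_ac)

lemma transpose_householder: "transpose (householder d) = householder d"
  by (simp add: householder_def transpose_def vec_eq_iff mat_def)

lemma householder_involution: "householder d *v (householder d *v x) = x"
  \<comment> \<open>For \<open>d = 0\<close> the quotient \<open>2 / 0\<close> is 0 and the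
    reflection degenerates to the identity, so no side condition on \<open>d\<close> arises.\<close>
  by (cases "d = 0") (simp_all add: householder_mult inner_diff_right inner_commute algebra_simps
      scaleR_left_diff_distrib[symmetric] scaleR_left_distrib[symmetric])

lemma orthogonal_matrix_householder: "orthogonal_matrix (householder d)"
  by (simp add: orthogonal_matrix transpose_householder matrix_eq householder_involution
      flip: matrix_vector_mul_assoc)

text \<open>Vectors of equal length are mirror images in the hyperplane orthogonal to their
  difference. This yields an explicit orthogonal matrix turning any vector into a multiple of a
  chosen axis.\<close>

lemma householder_swap:
  assumes "norm a = norm b"
  shows "householder (a - b) *v a = b"
proof (cases "a = b")
  case False
  have "(a - b) \<bullet> (a - b) = 2 * ((a - b) \<bullet> a)"
    using assms by (simp add: inner_diff_left inner_diff_right inner_commute norm_eq)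
  moreover have "(a - b) \<bullet> (a - b) \<noteq> 0" using False by simp
  ultimately show ?thesis by (simp add: householder_mult)
qed (simp add: householder_mult)

text \<open>Cramer's rule is a formula that is visibly measurable in the matrix, unlike a choice of inverse;
  on singular matrices its value is meaningless.\<close>

definition cramer_inv :: "real^'n^'n \<Rightarrow> real^'n^'n" where
  "cramer_inv M = (\<chi> i j. det (\<chi> a b. if b = i then axis j 1 $ a else M $ a $ b) / det M)"

lemma
  assumes "det M \<noteq> 0"
  shows cramer_inv_right: "M ** cramer_inv M = mat 1"
    and cramer_inv_left: "cramer_inv M ** M = mat 1"
proof -
  have "M *v column j (cramer_inv M) = axis j 1" for j
    by (subst cramer[OF assms]) (simp add: column_def cramer_inv_def)
  then show "M ** cramer_inv M = mat 1"
    by (simp add: vec_eq_iff matrix_matrix_mult_def matrix_vector_mult_def column_def axis_def mat_def)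
  then show "cramer_inv M ** M = mat 1"
    by (simp add: matrix_left_right_inverse)
qed

lemma cramer_inv_symmetric:
  assumes M: "det M \<noteq> 0" and sym: "transpose M = M"
  shows "transpose (cramer_inv M) = cramer_inv M"
proof -
  have "transpose (cramer_inv M) = transpose (cramer_inv M) ** (M ** cramer_inv M)"
    by (simp add: cramer_inv_right[OF M])
  also have "\<dots> = transpose (M ** cramer_inv M) ** cramer_inv M"
    by (simp add: matrix_transpose_mul sym matrix_mul_assoc)
  finally show ?thesis
    by (simp add: cramer_inv_right[OF M] transpose_mat)
qed

section \<open>Borel measurability of matrix operations\<close>

lemma borel_measurable_vec_lambda [measurable (raw)]:
  fixes f :: "'i::finite \<Rightarrow> 'a \<Rightarrow> 'b::euclidean_space"
  assumes [measurable]: "\<And>i. f i \<in> borel_measurable M"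
  shows "(\<lambda>x. \<chi> i. f i x) \<in> borel_measurable M"
  by (subst borel_measurable_euclidean_space) (auto simp: Basis_vec_def inner_axis)

lemma borel_measurable_vec_nth [measurable (raw)]:
  fixes f :: "'a \<Rightarrow> 'b::euclidean_space ^ 'i"
  assumes "f \<in> borel_measurable M"
  shows "(\<lambda>x. f x $ i) \<in> borel_measurable M"
  using assms by (rule borel_measurable_continuous_on[OF continuous_on_component[OF continuous_on_id]])

lemma borel_measurable_det [measurable (raw)]:
  fixes f :: "'a \<Rightarrow> real^'n^'n"
  assumes [measurable]: "f \<in> borel_measurable M"
  shows "(\<lambda>x. det (f x)) \<in> borel_measurable M"
  unfolding det_def by measurable

lemma borel_measurable_cramer_inv [measurable (raw)]:
  fixes f :: "'a \<Rightarrow> real^'n^'n"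
  assumes [measurable]: "f \<in> borel_measurable M"
  shows "(\<lambda>x. cramer_inv (f x)) \<in> borel_measurable M"
  unfolding cramer_inv_def by measurable

lemma borel_measurable_matrix_mult [measurable (raw)]:
  fixes f :: "'a \<Rightarrow> real^'m^'n" and g :: "'a \<Rightarrow> real^'k^'m"
  assumes [measurable]: "f \<in> borel_measurable M" "g \<in> borel_measurable M"
  shows "(\<lambda>x. f x ** g x) \<in> borel_measurable M"
  unfolding matrix_matrix_mult_def by measurable

lemma borel_measurable_matrix_vector_mult [measurable (raw)]:
  fixes f :: "'a \<Rightarrow> real^'m^'n" and g :: "'a \<Rightarrow> real^'m"
  assumes [measurable]: "f \<in> borel_measurable M" "g \<in> borel_measurable M"
  shows "(\<lambda>x. f x *v g x) \<in> borel_measurable M"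
  unfolding matrix_vector_mult_def by measurable

lemma borel_measurable_transpose [measurable (raw)]:
  fixes f :: "'a \<Rightarrow> real^'m^'n"
  assumes [measurable]: "f \<in> borel_measurable M"
  shows "(\<lambda>x. transpose (f x)) \<in> borel_measurable M"
  unfolding transpose_def by measurable

section \<open>Coordinate restriction and Gram matrices\<close>

definition diag_S :: "'p set \<Rightarrow> real^'p^'p" where
  "diag_S S = (\<chi> k l. if k = l \<and> k \<in> S then 1 else 0)"

text \<open>Represents the submatrix of the columns in \<open>S\<close>: the other columns are
  zeroed instead of deleted, which keeps the type fixed for every \<open>S\<close>.\<close>

definition cols :: "'p set \<Rightarrow> real^'p^'n \<Rightarrow> real^'p^'n" where
  "cols S A = (\<chi> i k. if k \<in> S then A $ i $ k else 0)"

definition restr :: "'p set \<Rightarrow> real^'p \<Rightarrow> real^'p" where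
  "restr S x = (\<chi> k. if k \<in> S then x $ k else 0)"

lemma borel_measurable_cols [measurable (raw)]:
  fixes f :: "'a \<Rightarrow> real^'p^'n"
  assumes [measurable]: "f \<in> borel_measurable M"
  shows "(\<lambda>x. cols S (f x)) \<in> borel_measurable M"
  unfolding cols_def by measurable

lemma borel_measurable_restr [measurable (raw)]:
  fixes f :: "'a \<Rightarrow> real^'p"
  assumes [measurable]: "f \<in> borel_measurable M"
  shows "(\<lambda>x. restr S (f x)) \<in> borel_measurable M"
  unfolding restr_def by measurable

lemma if_conj_eq: "(if a \<and> b then x else y) = (if a then if b then x else y else y)"
  by simp

lemma diag_S_mult [simp]: "diag_S S *v x = restr S x"
  by (simp add: diag_S_def restr_def matrix_vector_mult_def vec_eq_iff if_distrib[of "\<lambda>a. a * _"] cong: if_cong)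

lemma cols_eq: "cols S A = A ** diag_S S"
  by (simp add: cols_def diag_S_def matrix_matrix_mult_def vec_eq_iff if_conj_eq if_distrib[of "\<lambda>a. _ * a"] cong: if_cong)

lemma transpose_diag_S [simp]: "transpose (diag_S S) = diag_S S"
  by (auto simp: transpose_def diag_S_def vec_eq_iff)

lemma diag_S_idem [simp]: "diag_S S ** diag_S S = diag_S S"
  by (simp add: diag_S_def matrix_matrix_mult_def vec_eq_iff if_conj_eq if_distrib[of "\<lambda>a. _ * a"] cong: if_cong)

lemma cols_diag_S [simp]: "cols S A ** diag_S S = cols S A"
  by (simp add: cols_eq flip: matrix_mul_assoc)

lemma diag_S_transpose_cols [simp]: "diag_S S ** transpose (cols S A) = transpose (cols S A)"
  by (metis cols_diag_S matrix_transpose_mul transpose_diag_S)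

lemma trace_diag_S: "trace (diag_S S) = real (card S)"
  by (simp add: trace_def diag_S_def sum.If_cases)

definition row_gram :: "'p set \<Rightarrow> real^'p^'n \<Rightarrow> real^'n^'n" where
  "row_gram S A = cols S A ** transpose (cols S A)"

text \<open>The identity block on the complement of \<open>S\<close> allows the Gram matrix of the columns in \<open>S\<close> to be
  inverted without a type of cardinality \<open>card S\<close>.\<close>

definition col_gram :: "'p set \<Rightarrow> real^'p^'n \<Rightarrow> real^'p^'p" where
  "col_gram S A = transpose (cols S A) ** cols S A + (mat 1 - diag_S S)"

lemma gram_S_eq: "gram_S S A = row_gram S A"
  by (simp add: gram_S_def row_gram_def cols_def matrix_matrix_mult_def transpose_def vec_eq_iff
      sum.If_cases if_distrib[of "\<lambda>a. a * _"] if_distrib[of "\<lambda>a. _ * a"] cong: if_cong)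

lemma borel_measurable_row_gram [measurable (raw)]:
  fixes f :: "'a \<Rightarrow> real^'p^'n"
  assumes [measurable]: "f \<in> borel_measurable M"
  shows "(\<lambda>x. row_gram S (f x)) \<in> borel_measurable M"
  unfolding row_gram_def by measurable

lemma borel_measurable_col_gram [measurable (raw)]:
  fixes f :: "'a \<Rightarrow> real^'p^'n"
  assumes [measurable]: "f \<in> borel_measurable M"
  shows "(\<lambda>x. col_gram S (f x)) \<in> borel_measurable M"
  unfolding col_gram_def by measurable

lemma matrix_add_rdistrib: "(A + B) ** C = A ** C + B ** (C :: real^'k^'m)" for A B :: "real^'m^'n"
  by (simp add: matrix_matrix_mult_def vec_eq_iff distrib_right sum.distrib)

lemma matrix_diff_rdistrib: "(A - B) ** C = A ** C - B ** (C :: real^'k^'m)" for A B :: "real^'m^'n"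
  by (simp add: matrix_matrix_mult_def vec_eq_iff left_diff_distrib sum_subtractf)

lemma transpose_add: "transpose (A + B) = transpose A + transpose (B :: real^'m^'n)"
  by (simp add: transpose_def vec_eq_iff)

lemma transpose_diff: "transpose (A - B) = transpose A - transpose (B :: real^'m^'n)"
  by (simp add: transpose_def vec_eq_iff)

lemma transpose_row_gram: "transpose (row_gram S A) = row_gram S A"
  by (simp add: row_gram_def matrix_transpose_mul)

lemma transpose_col_gram: "transpose (col_gram S A) = col_gram S A"
  by (simp add: col_gram_def matrix_transpose_mul transpose_add transpose_diff transpose_mat)

text \<open>The case of independent rows: \<open>W\<close> is a right inverse of
  \<open>cols S A\<close>, from which the Penrose conditions and both traces follow.\<close>

lemma
  assumes "det (row_gram S A) \<noteq> 0"
  defines "W \<equiv> transpose (cols S A) ** cramer_inv (row_gram S A)"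
  shows is_pinv_row: "is_pinv (cols S A) W"
    and trace_mul_row: "trace (W ** cols S (A :: real^'p^'n)) = real CARD('n)"
    and trace_gram_row: "trace (transpose W ** W) = trace (cramer_inv (row_gram S A))"
    and cramer_inv_row_gram_nonneg: "0 \<le> cramer_inv (row_gram S A) $ i $ i"
proof -
  let ?B = "cols S A" and ?R = "cramer_inv (row_gram S A)"
  have sym: "transpose ?R = ?R"
    by (rule cramer_inv_symmetric[OF assms(1) transpose_row_gram])
  have BW: "?B ** W = mat 1"
    using cramer_inv_right[OF assms(1)] by (simp add: W_def row_gram_def matrix_mul_assoc)
  have "transpose (W ** ?B) = W ** ?B"
    by (simp add: W_def matrix_transpose_mul sym matrix_mul_assoc)
  with BW show pinv: "is_pinv ?B W"
    by (simp add: is_pinv_def transpose_mat flip: matrix_mul_assoc)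
  show "trace (W ** ?B) = real CARD('n)"
    using BW by (simp add: trace_mul_sym[of W] trace_I)
  have "transpose W ** W = ?R ** (?B ** W)"
    by (simp add: W_def matrix_transpose_mul sym matrix_mul_assoc)
  then have WW: "transpose W ** W = ?R"
    by (simp add: BW)
  then show "trace (transpose W ** W) = trace ?R" by simp
  show "0 \<le> ?R $ i $ i"
    by (simp add: matrix_matrix_mult_def transpose_def sum_nonneg flip: WW)
qed

text \<open>The case of independent columns: \<open>W\<close> is a left inverse on the coordinates
  in \<open>S\<close>, that is, \<open>W ** cols S A\<close> is \<open>diag_S S\<close>. The block
  form of \<open>col_gram\<close> makes its inverse commute with \<open>diag_S S\<close>, so the
  trace of \<open>W\<close> transposed times \<open>W\<close> picks out the diagonal entries with
  index in \<open>S\<close>.\<close>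

lemma
  assumes "det (col_gram S A) \<noteq> 0"
  defines "W \<equiv> cramer_inv (col_gram S A) ** transpose (cols S A)"
  shows is_pinv_col: "is_pinv (cols S A) W"
    and trace_mul_col: "trace (W ** cols S A) = real (card S)"
    and trace_gram_col: "trace (transpose W ** W) = (\<Sum>k\<in>S. cramer_inv (col_gram S A) $ k $ k)"
    and cramer_inv_col_gram_nonneg: "k \<in> S \<Longrightarrow> 0 \<le> cramer_inv (col_gram S A) $ k $ k"
proof -
  let ?B = "cols S A" and ?H = "col_gram S A" and ?R = "cramer_inv (col_gram S A)" and ?D = "diag_S S"
  note RH = cramer_inv_left[OF assms(1)] and HR = cramer_inv_right[OF assms(1)]
  have sym: "transpose ?R = ?R"
    by (rule cramer_inv_symmetric[OF assms(1) transpose_col_gram])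
  \<comment> \<open>Multiplication by \<open>?D\<close> strips the identity block from
    \<open>?H\<close>.\<close>
  have HD: "?H ** ?D = transpose ?B ** ?B"
    by (simp add: col_gram_def matrix_add_rdistrib matrix_diff_rdistrib flip: matrix_mul_assoc)
  have WB: "W ** ?B = ?D"
    by (simp add: W_def flip: matrix_mul_assoc HD) (simp add: RH matrix_mul_assoc)
  have "?D ** ?H = ?H ** ?D"
    by (metis HD matrix_transpose_mul transpose_col_gram transpose_diag_S transpose_transpose)
  then have DR: "?D ** ?R = ?R ** ?D"
  proof -
    assume comm: "?D ** ?H = ?H ** ?D"
    have "?D ** ?R = ?R ** (?H ** ?D) ** ?R"
      by (simp add: matrix_mul_assoc RH)
    also have "\<dots> = ?R ** ?D ** (?H ** ?R)"
      by (simp only: comm[symmetric] matrix_mul_assoc)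
    finally show ?thesis by (simp add: HR)
  qed
  have "transpose (?B ** W) = ?B ** W"
    by (simp add: W_def matrix_transpose_mul sym matrix_mul_assoc)
  moreover have DW: "?D ** W = W"
    by (simp add: W_def matrix_mul_assoc DR) (simp flip: matrix_mul_assoc)
  ultimately show "is_pinv ?B W"
    by (simp add: is_pinv_def WB) (simp add: WB flip: matrix_mul_assoc)
  show "trace (W ** ?B) = real (card S)"
    by (simp add: WB trace_diag_S)
  have WW: "W ** transpose W = ?D ** ?R"
    using WB by (simp add: W_def matrix_transpose_mul sym matrix_mul_assoc)
  have DR_nth: "(?D ** ?R) $ k $ k = (if k \<in> S then ?R $ k $ k else 0)" for k
    by (simp add: diag_S_def matrix_matrix_mult_def if_distrib[of "\<lambda>a. a * _"] cong: if_cong)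
  then have "trace (?D ** ?R) = (\<Sum>k\<in>S. ?R $ k $ k)"
    by (simp only: trace_def) (simp add: sum.If_cases)
  then show "trace (transpose W ** W) = (\<Sum>k\<in>S. ?R $ k $ k)"
    by (simp add: trace_mul_sym[of "transpose W"] WW)
  have "0 \<le> (W ** transpose W) $ k $ k"
    by (simp add: matrix_matrix_mult_def transpose_def sum_nonneg)
  then show "k \<in> S \<Longrightarrow> 0 \<le> ?R $ k $ k"
    by (simp add: WW DR_nth)
qed

section \<open>Almost sure nondegeneracy and resampling\<close>

text \<open>A predicate on functions, so that closure under sums and products covers determinants
  without naming the polynomial.\<close>

definition poly_fun :: "(real \<Rightarrow> real) \<Rightarrow> bool" where
  "poly_fun f \<longleftrightarrow> (\<exists>q. f = poly q)"

lemma poly_fun_const: "poly_fun (\<lambda>t. c)"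
  unfolding poly_fun_def by (intro exI[of _ "[:c:]"]) auto

lemma poly_fun_ident: "poly_fun (\<lambda>t. t)"
  unfolding poly_fun_def by (intro exI[of _ "[:0, 1:]"]) auto

lemma poly_fun_add: "poly_fun f \<Longrightarrow> poly_fun g \<Longrightarrow> poly_fun (\<lambda>t. f t + g t)"
  unfolding poly_fun_def by (auto simp flip: poly_add)

lemma poly_fun_mult: "poly_fun f \<Longrightarrow> poly_fun g \<Longrightarrow> poly_fun (\<lambda>t. f t * g t)"
  unfolding poly_fun_def by (auto simp flip: poly_mult)

lemma poly_fun_sum: "(\<And>i. i \<in> I \<Longrightarrow> poly_fun (f i)) \<Longrightarrow> poly_fun (\<lambda>t. \<Sum>i\<in>I. f i t)"
  by (induction I rule: infinite_finite_induct) (auto intro: poly_fun_const poly_fun_add)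

lemma poly_fun_prod: "(\<And>i. i \<in> I \<Longrightarrow> poly_fun (f i)) \<Longrightarrow> poly_fun (\<lambda>t. \<Prod>i\<in>I. f i t)"
  by (induction I rule: infinite_finite_induct) (auto intro: poly_fun_const poly_fun_mult)

lemma poly_fun_det:
  assumes "\<And>i j. poly_fun (\<lambda>t. M t $ i $ j)"
  shows "poly_fun (\<lambda>t. det (M t :: real^'n^'n))"
  unfolding det_def by (intro poly_fun_sum poly_fun_mult poly_fun_const poly_fun_prod assms)

text \<open>On every line through a point where \<open>f\<close> does not vanish there are only finitely many
  zeros; Fubini transfers this to some, hence to every, dilate of the zero set.\<close>

lemma AE_nonzero_of_poly_on_lines:
  fixes f :: "'a::euclidean_space \<Rightarrow> real"
  assumes [measurable]: "f \<in> borel_measurable borel"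
    and poly: "\<And>x. poly_fun (\<lambda>t. f (a + t *\<^sub>R x))" and nz: "f a \<noteq> 0"
  shows "AE x in lborel. f x \<noteq> 0"
proof -
  define Z where "Z = {x. f (a + x) = 0}"
  have [measurable]: "Z \<in> sets borel" unfolding Z_def by measurable
  have fin: "finite {t. t *\<^sub>R x \<in> Z}" for x
  proof -
    obtain q where q: "(\<lambda>t. f (a + t *\<^sub>R x)) = poly q"
      using poly by (auto simp: poly_fun_def)
    have "poly q 0 \<noteq> 0" using nz by (simp flip: q)
    then have "finite {t. poly q t = 0}" by (intro poly_roots_finite) auto
    then show ?thesis by (simp add: Z_def fun_cong[OF q])
  qed
  have "(\<integral>\<^sup>+x. (\<integral>\<^sup>+t. indicator Z (t *\<^sub>R x) \<partial>lborel) \<partial>lborel) = (\<integral>\<^sup>+(x::'a). 0 \<partial>lborel)"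
  proof (rule nn_integral_cong)
    fix x :: 'a
    have "(\<integral>\<^sup>+t. indicator Z (t *\<^sub>R x) \<partial>lborel) = (\<integral>\<^sup>+t. indicator {t. t *\<^sub>R x \<in> Z} t \<partial>(lborel :: real measure))"
      by (simp add: indicator_def)
    also have "\<dots> = 0"
      using fin[of x] by (subst nn_integral_indicator) (auto intro: finite_imp_null_set_lborel null_setsD1 borel_closed finite_imp_closed)
    finally show "(\<integral>\<^sup>+t. indicator Z (t *\<^sub>R x) \<partial>lborel) = 0" .
  qed
  then have "(\<integral>\<^sup>+t. (\<integral>\<^sup>+x. indicator Z (t *\<^sub>R x) \<partial>lborel) \<partial>(lborel :: real measure)) = 0"
    by (subst lborel_pair.Fubini') auto
  then have "AE t in (lborel :: real measure). (\<integral>\<^sup>+x. indicator Z (t *\<^sub>R x) \<partial>(lborel :: 'a measure)) = 0"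
    by (subst (asm) nn_integral_0_iff_AE) auto
  moreover have "AE t in (lborel :: real measure). t \<noteq> 0"
    by (rule AE_lborel_singleton)
  ultimately have "AE t in (lborel :: real measure). t \<noteq> 0 \<and> (\<integral>\<^sup>+x. indicator Z (t *\<^sub>R x) \<partial>(lborel :: 'a measure)) = 0"
    by eventually_elim simp
  then have "\<exists>t. t \<noteq> 0 \<and> (\<integral>\<^sup>+x. indicator Z (t *\<^sub>R x) \<partial>(lborel :: 'a measure)) = 0"
    by (rule eventually_happens'[rotated]) (simp add: ae_filter_eq_bot_iff)
  then obtain t where t: "t \<noteq> 0" and int0: "(\<integral>\<^sup>+x. indicator Z (t *\<^sub>R x) \<partial>lborel) = 0"
    by blast
  define h :: "'a \<Rightarrow> ennreal" where "h = indicator Z"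
  have [measurable]: "h \<in> borel_measurable borel" unfolding h_def by measurable
  \<comment> \<open>Scaling by \<open>t\<close> changes the integral only by a power of
    \<open>\<bar>t\<bar>\<close>, so the null dilate found above forces \<open>Z\<close> itself to
    be null.\<close>
  have "(\<integral>\<^sup>+x. h x \<partial>lborel)
      = (\<integral>\<^sup>+x. h x \<partial>density (distr lborel borel (\<lambda>x. 0 + t *\<^sub>R x)) (\<lambda>_. ennreal (\<bar>t\<bar> ^ DIM('a))))"
    by (subst lborel_affine[OF t, of 0, symmetric]) (rule refl)
  also have "\<dots> = ennreal (\<bar>t\<bar> ^ DIM('a)) * (\<integral>\<^sup>+x. h (t *\<^sub>R x) \<partial>lborel)"
    by (simp add: nn_integral_density nn_integral_distr nn_integral_cmult)
  finally have "(\<integral>\<^sup>+x. indicator Z x \<partial>lborel) = 0" using int0 by (simp add: h_def)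
  then have "(\<integral>\<^sup>+x. indicator {x. f x = 0} x \<partial>lborel) = 0"
    using nn_integral_lborel_translate[of "indicator {x. f x = 0}" a]
    by (simp add: Z_def indicator_def)
  then show ?thesis
    by (subst (asm) nn_integral_0_iff_AE) (auto simp: indicator_eq_0_iff)
qed

lemma AE_std_gaussianI: "AE x in lborel. P x \<Longrightarrow> AE x in std_gaussian. P x"
  unfolding std_gaussian_def by (subst AE_density) auto

lemma poly_fun_cols: "poly_fun (\<lambda>t. cols S (A0 + t *\<^sub>R A) $ i $ k)"
  by (cases "k \<in> S") (auto simp: cols_def intro!: poly_fun_mult poly_fun_const poly_fun_add poly_fun_ident)

lemma AE_det_row_gram:
  assumes "CARD('n) \<le> card S"
  shows "AE A in (std_gaussian :: (real^'p^'n) measure). det (row_gram S A) \<noteq> 0"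
proof -
  obtain f :: "'n \<Rightarrow> 'p" where f: "inj f" "range f \<subseteq> S"
    using card_le_inj[of "UNIV :: 'n set" S] assms by auto
  \<comment> \<open>The rows are distinct unit vectors supported on \<open>S\<close>, so their Gram
    matrix is the identity: a base point where the determinant does not vanish.\<close>
  define A0 :: "real^'p^'n" where "A0 = (\<chi> i k. if k = f i then 1 else 0)"
  have "cols S A0 = A0"
    using f by (auto simp: cols_def A0_def vec_eq_iff)
  then have "row_gram S A0 $ i $ j = mat 1 $ i $ j" for i j
    using f by (simp add: row_gram_def A0_def transpose_def matrix_matrix_mult_def mat_def
        if_distrib[of "\<lambda>a. a * _"] inj_eq cong: if_cong)
  then have "row_gram S A0 = mat 1"
    by (simp add: vec_eq_iff)
  then have "det (row_gram S A0) \<noteq> 0" by simp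
  moreover have "poly_fun (\<lambda>t. det (row_gram S (A0 + t *\<^sub>R A)))" for A
    unfolding row_gram_def transpose_def matrix_matrix_mult_def
    by (rule poly_fun_det, simp)
       (intro poly_fun_sum poly_fun_mult poly_fun_const poly_fun_add poly_fun_cols)
  ultimately show ?thesis
    by (intro AE_std_gaussianI AE_nonzero_of_poly_on_lines) measurable
qed

lemma AE_det_col_gram:
  assumes "card S \<le> CARD('n)"
  shows "AE A in (std_gaussian :: (real^'p^'n) measure). det (col_gram S A) \<noteq> 0"
proof -
  obtain g :: "'p \<Rightarrow> 'n" where g: "inj_on g S"
    using card_le_inj[of S "UNIV :: 'n set"] assms by auto
  \<comment> \<open>The columns with index in \<open>S\<close> are distinct unit vectors, which
    makes \<open>col_gram\<close> the identity at this base point.\<close>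
  define A0 :: "real^'p^'n" where "A0 = (\<chi> i k. if i = g k then 1 else 0)"
  have "col_gram S A0 = mat 1"
    using g by (auto simp: col_gram_def A0_def cols_def transpose_def matrix_matrix_mult_def vec_eq_iff mat_def
        if_distrib[of "\<lambda>a. a * _"] diag_S_def inj_on_eq_iff cong: if_cong)
  then have "det (col_gram S A0) \<noteq> 0" by simp
  moreover have "poly_fun (\<lambda>t. det (col_gram S (A0 + t *\<^sub>R A)))" for A
    unfolding col_gram_def transpose_def matrix_matrix_mult_def
    by (rule poly_fun_det, simp del: vector_minus_component add: vector_add_component)
       (intro poly_fun_sum poly_fun_mult poly_fun_const poly_fun_add poly_fun_cols)
  ultimately show ?thesis
    by (intro AE_std_gaussianI AE_nonzero_of_poly_on_lines) measurable
qed

text \<open>Exchanging the \<open>Q\<close>-parts of two independent standard Gaussian vectors is an orthogonal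
  transformation of the pair.\<close>

lemma nn_integral_std_gaussian_resample:
  fixes Q :: "'a::euclidean_space \<Rightarrow> 'a"
  assumes lin: "linear Q" and idem: "\<And>x. Q (Q x) = Q x" and sa: "\<And>x y. Q x \<bullet> y = x \<bullet> Q y"
    and [measurable]: "f \<in> borel_measurable borel"
  shows "(\<integral>\<^sup>+x. (\<integral>\<^sup>+y. f (x - Q x + Q y) \<partial>std_gaussian) \<partial>std_gaussian) = (\<integral>\<^sup>+x. f x \<partial>std_gaussian)"
proof -
  define T where "T = (\<lambda>(x, y). (x - Q x + Q y, y - Q y + Q x))"
  have [measurable]: "Q \<in> borel \<rightarrow>\<^sub>M borel"
    using lin by (intro borel_measurable_continuous_onI linear_continuous_on) (simp add: linear_linear)
  have "linear T"
    unfolding T_def using lin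
    by (intro linearI) (auto simp: linear_add linear_scale algebra_simps)
  moreover have "T z \<bullet> T z' = z \<bullet> z'" for z z'
    by (cases z; cases z') (simp add: T_def inner_Pair inner_add_left inner_add_right inner_diff_left inner_diff_right
        sa idem)
  ultimately have T: "orthogonal_transformation T"
    by (simp add: orthogonal_transformation_def)
  have [measurable]: "(\<lambda>z :: 'a \<times> 'a. f (fst z)) \<in> borel_measurable borel"
    by (simp flip: borel_prod)
  have "(\<integral>\<^sup>+x. (\<integral>\<^sup>+y. f (x - Q x + Q y) \<partial>std_gaussian) \<partial>std_gaussian)
      = (\<integral>\<^sup>+x. (\<integral>\<^sup>+y. f (fst (T (x, y))) \<partial>std_gaussian) \<partial>std_gaussian)"
    by (simp add: T_def)
  also have "\<dots> = (\<integral>\<^sup>+z. f (fst (T z)) \<partial>std_gaussian)"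
    using borel_measurable_orthogonal_transformation[OF T]
    by (intro nn_integral_std_gaussian_prod) measurable
  also have "\<dots> = (\<integral>\<^sup>+z. f (fst z) \<partial>(std_gaussian :: ('a \<times> 'a) measure))"
    by (rule nn_integral_std_gaussian_orthogonal_transformation[OF T]) measurable
  also have "\<dots> = (\<integral>\<^sup>+x. (\<integral>\<^sup>+y. f (fst (x, y :: 'a)) \<partial>std_gaussian) \<partial>std_gaussian)"
    by (rule nn_integral_std_gaussian_prod[symmetric]) measurable
  also have "\<dots> = (\<integral>\<^sup>+x. f x \<partial>std_gaussian)"
    using std_gaussian.emeasure_space_1[where 'a='a] by simp
  finally show ?thesis .
qed

text \<open>The integral identity for the indicator of the exceptional set, whose mean is 0.\<close>

lemma AE_std_gaussian_resample:
  fixes Q :: "'a::euclidean_space \<Rightarrow> 'a"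
  assumes lin: "linear Q" and idem: "\<And>x. Q (Q x) = Q x" and sa: "\<And>x y. Q x \<bullet> y = x \<bullet> Q y"
    and P [measurable]: "Measurable.pred borel P" and AE: "AE x in std_gaussian. P x"
  shows "AE x in std_gaussian. AE y in std_gaussian. P (x - Q x + Q y)"
proof -
  have [measurable]: "Q \<in> borel \<rightarrow>\<^sub>M borel"
    using lin by (intro borel_measurable_continuous_onI linear_continuous_on) (simp add: linear_linear)
  have "(\<integral>\<^sup>+x. (\<integral>\<^sup>+y. indicator {x. \<not> P x} (x - Q x + Q y) \<partial>std_gaussian) \<partial>std_gaussian)
      = (\<integral>\<^sup>+x. indicator {x. \<not> P x} x \<partial>std_gaussian)"
    by (rule nn_integral_std_gaussian_resample[OF lin idem sa]) measurable
  also have "\<dots> = 0"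
    using AE by (subst nn_integral_0_iff_AE) (auto simp: indicator_eq_0_iff)
  finally have "AE x in std_gaussian. (\<integral>\<^sup>+y. indicator {x. \<not> P x} (x - Q x + Q y) \<partial>std_gaussian) = 0"
    by (subst (asm) nn_integral_0_iff_AE) auto
  then show ?thesis
  proof eventually_elim
    case (elim x)
    then show ?case
      by (subst (asm) nn_integral_0_iff_AE) (auto simp: indicator_eq_0_iff)
  qed
qed

text \<open>Pairing a vanishing combination with \<open>w k\<close> isolates one coefficient. An
  inverse Gram matrix supplies such a dual family, so its existence yields the dimension of the span
  of rows or columns.\<close>

lemma dim_span_dual_family:
  fixes f w :: "'k \<Rightarrow> 'a::euclidean_space"
  assumes fin: "finite K" and dual: "\<And>k l. k \<in> K \<Longrightarrow> l \<in> K \<Longrightarrow> w k \<bullet> f l = (if k = l then 1 else 0)"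
  shows "dim (span (f ` K)) = card K"
proof -
  have inj: "inj_on f K"
  proof (rule inj_onI)
    fix k l assume "k \<in> K" "l \<in> K" "f k = f l"
    then show "k = l" using dual[of k k] dual[of k l] by (auto split: if_splits)
  qed
  have "independent (f ` K)"
  proof (rule independent_if_scalars_zero)
    fix c x assume s: "(\<Sum>x\<in>f ` K. c x *\<^sub>R x) = 0" and "x \<in> f ` K"
    then obtain k where k: "k \<in> K" "x = f k" by auto
    have "0 = w k \<bullet> (\<Sum>l\<in>K. c (f l) *\<^sub>R f l)"
      using s by (simp add: sum.reindex[OF inj])
    also have "\<dots> = (\<Sum>l\<in>K. c (f l) * (if k = l then 1 else 0))"
      using k by (simp add: inner_sum_right dual)
    also have "\<dots> = c x" using k fin by (simp add: if_distrib cong: if_cong)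
    finally show "c x = 0" by simp
  qed (use fin in simp)
  then show ?thesis
    using inj by (simp add: dim_eq_card_independent card_image)
qed

lemma orthonormal_complement:
  fixes U :: "'a::euclidean_space set"
  assumes U: "subspace U"
  obtains E where "pairwise orthogonal E" "\<And>e. e \<in> E \<Longrightarrow> norm e = 1" "finite E"
    "card E = DIM('a) - dim U" "\<And>e u. e \<in> E \<Longrightarrow> u \<in> U \<Longrightarrow> u \<bullet> e = 0"
    "\<And>w. (\<And>u. u \<in> U \<Longrightarrow> u \<bullet> w = 0) \<Longrightarrow> w \<in> span E"
proof -
  let ?C = "{y \<in> UNIV. \<forall>x\<in>U. orthogonal x y}"
  have "subspace ?C"
    by (simp add: subspace_orthogonal_to_vectors)
  then obtain E where E: "E \<subseteq> ?C" "pairwise orthogonal E" "\<And>x. x \<in> E \<Longrightarrow> norm x = 1"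
    "independent E" "card E = dim ?C" "span E = ?C"
    by (rule orthonormal_basis_subspace) blast
  have "dim ?C + dim U = DIM('a)"
    using dim_subspace_orthogonal_to_vectors[OF U subspace_UNIV] by simp
  moreover have "finite E" using E(4) independent_bound by auto
  ultimately show ?thesis
    using E by (intro that[of E]) (auto simp: orthogonal_def)
qed

text \<open>Here \<open>E\<close> spans the complement of the other rows or columns,
  \<open>c\<close> is the singled-out one and \<open>w\<close> its dual vector. Along
  \<open>E\<close>, \<open>w\<close> has the same components as \<open>\<alpha> *\<^sub>R c\<close>,
  so \<open>w \<bullet> c = 1\<close> says that \<open>\<alpha>\<close> times the squared distance
  of \<open>c\<close> from the span of the others is 1.\<close>

lemma inverse_gram_entry:
  fixes c w :: "'a::euclidean_space"
  assumes E: "pairwise orthogonal E" "\<And>e. e \<in> E \<Longrightarrow> norm e = 1" "finite E"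
    and EU: "\<And>e. e \<in> E \<Longrightarrow> (w - \<alpha> *\<^sub>R c) \<bullet> e = 0" and w: "w \<in> span E" and wc: "w \<bullet> c = 1"
  shows "ennreal \<alpha> = inverse (ennreal (\<Sum>e\<in>E. (c \<bullet> e)\<^sup>2))"
proof -
  have "1 = (\<Sum>e\<in>E. (w \<bullet> e) *\<^sub>R e) \<bullet> c"
    using orthonormal_basis_expand[OF E(1,2) w E(3)] wc by simp
  also have "\<dots> = (\<Sum>e\<in>E. (w \<bullet> e) * (c \<bullet> e))"
    by (simp add: inner_sum_left inner_commute[of c])
  also have "\<dots> = \<alpha> * (\<Sum>e\<in>E. (c \<bullet> e)\<^sup>2)"
    using EU by (simp add: inner_diff_left sum_distrib_left power2_eq_square mult.assoc)
  finally have 1: "\<alpha> * (\<Sum>e\<in>E. (c \<bullet> e)\<^sup>2) = 1" by simp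
  have "0 < (\<Sum>e\<in>E. (c \<bullet> e)\<^sup>2)"
    using 1 sum_nonneg[of E "\<lambda>e. (c \<bullet> e)\<^sup>2"] by (metis less_eq_real_def mult_zero_right zero_le_power2 zero_neq_one)
  moreover from this have "\<alpha> = inverse (\<Sum>e\<in>E. (c \<bullet> e)\<^sup>2)"
    using 1 by (simp add: field_simps)
  ultimately show ?thesis
    by (simp add: inverse_ennreal)
qed

section \<open>Diagonal entries of inverse Gram matrices\<close>

text \<open>The maps \<open>emb\<close> and \<open>proj\<close> insert and extract one row or column
  of a matrix. As \<open>emb\<close> is isometric with adjoint \<open>proj\<close>, the images of
  \<open>E\<close> are orthonormal in the large space and the chi-squared formula applies
  there.\<close>

lemma nn_integral_std_gaussian_inverse_chi_square_isometry:
  fixes emb :: "'b::euclidean_space \<Rightarrow> 'a::euclidean_space" and proj :: "'a \<Rightarrow> 'b"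
  assumes E: "pairwise orthogonal E" "\<And>e. e \<in> E \<Longrightarrow> norm e = 1"
    and iso: "\<And>e e'. emb e \<bullet> emb e' = e \<bullet> e'" and adj: "\<And>x e. x \<bullet> emb e = proj x \<bullet> e"
  shows "(\<integral>\<^sup>+x. inverse (ennreal (\<Sum>e\<in>E. (proj x \<bullet> e)\<^sup>2)) \<partial>std_gaussian)
       = (if 2 < card E then ennreal (1 / (real (card E) - 2)) else \<infinity>)"
proof -
  have inj: "inj_on emb E"
  proof (rule inj_onI)
    fix x y assume "x \<in> E" "y \<in> E" "emb x = emb y"
    then have "x \<bullet> y = x \<bullet> x" by (metis iso)
    then have "\<not> orthogonal x y" using E(2)[OF \<open>x \<in> E\<close>] by (auto simp: orthogonal_def norm_eq_1)
    then show "x = y" using E(1) \<open>x \<in> E\<close> \<open>y \<in> E\<close> by (auto simp: pairwise_def)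
  qed
  have "(\<integral>\<^sup>+x. inverse (ennreal (\<Sum>e\<in>emb ` E. (x \<bullet> e)\<^sup>2)) \<partial>std_gaussian)
       = (if 2 < card (emb ` E) then ennreal (1 / (real (card (emb ` E)) - 2)) else \<infinity>)"
    using E by (intro nn_integral_std_gaussian_inverse_chi_square)
      (auto simp: pairwise_def orthogonal_def iso norm_eq_1)
  then show ?thesis
    by (simp add: sum.reindex[OF inj] card_image[OF inj] adj)
qed

lemma inner_span_eq_0:
  assumes "\<And>x. x \<in> F \<Longrightarrow> x \<bullet> w = 0" and "u \<in> span F"
  shows "u \<bullet> w = (0::real)"
  using assms orthogonal_to_span[of u F w] by (simp add: orthogonal_def inner_commute)

lemma inner_restr:
  assumes "\<And>k. k \<notin> S \<Longrightarrow> w $ k = 0"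
  shows "w \<bullet> restr S x = w \<bullet> x"
  using assms by (auto simp: restr_def inner_vec_def intro!: sum.cong)

lemma row_gram_nth: "row_gram S A $ i $ j = restr S (A $ i) \<bullet> restr S (A $ j)"
  by (simp add: row_gram_def cols_def restr_def matrix_matrix_mult_def transpose_def inner_vec_def)

lemma col_gram_nth:
  "col_gram S A $ k $ l = (if k \<in> S \<and> l \<in> S then column k A \<bullet> column l A else if k = l then 1 else 0)"
  by (auto simp: col_gram_def cols_def column_def matrix_matrix_mult_def transpose_def inner_vec_def
      diag_S_def mat_def)

text \<open>Read entrywise, inverse times Gram matrix equal to the identity says that the rows of
  the inverse are the coefficients of a dual basis.\<close>

lemma row_dual_inner:
  assumes "det (row_gram S A) \<noteq> 0"
  shows "(\<Sum>m\<in>UNIV. cramer_inv (row_gram S A) $ i $ m *\<^sub>R restr S (A $ m)) \<bullet> restr S (A $ j)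
       = (if i = j then 1 else 0)"
proof -
  have "(cramer_inv (row_gram S A) ** row_gram S A) $ i $ j = mat 1 $ i $ j"
    by (simp add: cramer_inv_left[OF assms])
  then show ?thesis
    by (simp add: inner_sum_left row_gram_nth matrix_matrix_mult_def mat_def)
qed

lemma col_dual_inner:
  assumes "det (col_gram S A) \<noteq> 0" "l \<in> S"
  shows "(\<Sum>m\<in>S. cramer_inv (col_gram S A) $ k $ m *\<^sub>R column m A) \<bullet> column l A
       = (if k = l then 1 else 0)"
proof -
  have "(\<Sum>m\<in>S. cramer_inv (col_gram S A) $ k $ m *\<^sub>R column m A) \<bullet> column l A
      = (\<Sum>m\<in>S. cramer_inv (col_gram S A) $ k $ m * col_gram S A $ m $ l)"
    using assms(2) by (simp add: inner_sum_left col_gram_nth)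
  also have "\<dots> = (\<Sum>m\<in>UNIV. cramer_inv (col_gram S A) $ k $ m * col_gram S A $ m $ l)"
    using assms(2) by (intro sum.mono_neutral_left) (auto simp: col_gram_nth)
  also have "\<dots> = (cramer_inv (col_gram S A) ** col_gram S A) $ k $ l"
    by (simp add: matrix_matrix_mult_def)
  finally show ?thesis
    by (simp add: cramer_inv_left[OF assms(1)] mat_def)
qed

text \<open>Resample row \<open>i\<close> while keeping the others. The entry is then the inverse
  squared distance of a fresh Gaussian row, restricted to \<open>S\<close>, from the span of the
  other \<open>n - 1\<close> restricted rows, which leaves \<open>card S - n + 1\<close> degrees of
  freedom.\<close>

lemma nn_integral_cramer_inv_row_gram:
  fixes S :: "'p::finite set" and i :: "'n::finite"
  assumes le: "CARD('n) \<le> card S"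
  shows "(\<integral>\<^sup>+A. ennreal (cramer_inv (row_gram S A) $ i $ i) \<partial>(std_gaussian :: (real^'p^'n) measure))
       = (if CARD('n) + 1 < card S then ennreal (1 / (real (card S) - real CARD('n) - 1)) else \<infinity>)"
proof -
  define Q :: "real^'p^'n \<Rightarrow> real^'p^'n" where "Q A = (\<chi> j. if j = i then A $ j else 0)" for A
  have Q: "linear Q" "\<And>A. Q (Q A) = Q A" "\<And>A B. Q A \<bullet> B = A \<bullet> Q B"
    by (auto simp: Q_def linear_iff vec_eq_iff inner_vec_def intro!: sum.cong)
  define N where "N A B = A - Q A + Q B" for A B
  have N_nth: "N A B $ m = (if m = i then B $ i else A $ m)" for A B m
    by (simp add: N_def Q_def)
  let ?d = "card S - CARD('n) + 1"
  have card_S: "card S \<le> CARD('p)" by (simp add: card_mono)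
  have main: "(\<integral>\<^sup>+B. ennreal (cramer_inv (row_gram S (N A B)) $ i $ i) \<partial>std_gaussian)
      = (if 2 < ?d then ennreal (1 / (real ?d - 2)) else \<infinity>)"
    if A: "det (row_gram S A) \<noteq> 0" and AE: "AE B in std_gaussian. det (row_gram S (N A B)) \<noteq> 0" for A
  proof -
    \<comment> \<open>Besides the other rows, the axes outside \<open>S\<close> are included, so
      that the orthogonal complement lies inside the coordinates of \<open>S\<close>. The family
      \<open>w\<close> is dual to \<open>f\<close> on \<open>K\<close> and serves to compute the
      dimension.\<close>
    define f :: "'n + 'p \<Rightarrow> real^'p" where
      "f = case_sum (\<lambda>j. restr S (A $ j)) (\<lambda>k. axis k 1)"
    define w :: "'n + 'p \<Rightarrow> real^'p" where
      "w = case_sum (\<lambda>j. \<Sum>m\<in>UNIV. cramer_inv (row_gram S A) $ j $ m *\<^sub>R restr S (A $ m)) (\<lambda>k. axis k 1)"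
    define K :: "('n + 'p) set" where "K = Inl ` (- {i}) \<union> Inr ` (- S)"
    have restr_axis: "restr S x \<bullet> axis k 1 = 0" if "k \<notin> S" for x k
      using that by (simp add: inner_axis restr_def)
    have "w k \<bullet> f l = (if k = l then 1 else 0)" if "k \<in> K" "l \<in> K" for k l
      using that
      by (auto simp: K_def w_def f_def row_dual_inner[OF A, unfolded inner_sum_left inner_scaleR_left]
          inner_sum_left restr_axis inner_axis_axis inner_commute[of "axis _ _" "restr _ _"] split: if_splits)
    then have "dim (span (f ` K)) = card K"
      by (intro dim_span_dual_family[where w=w]) auto
    moreover have "card K = (CARD('n) - 1) + (CARD('p) - card S)"
      unfolding K_def
      by (subst card_Un_disjoint) (auto simp: card_image inj_on_def Compl_eq_Diff_UNIV card_Diff_subset)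
    ultimately have dimU: "dim (span (f ` K)) = (CARD('n) - 1) + (CARD('p) - card S)" by simp
    obtain E where E: "pairwise orthogonal E" "\<And>e. e \<in> E \<Longrightarrow> norm e = 1" "finite E"
      and cardE: "card E = DIM(real^'p) - dim (span (f ` K))"
      and EU: "\<And>e u. e \<in> E \<Longrightarrow> u \<in> span (f ` K) \<Longrightarrow> u \<bullet> e = 0"
      and spanE: "\<And>w. (\<And>u. u \<in> span (f ` K) \<Longrightarrow> u \<bullet> w = 0) \<Longrightarrow> w \<in> span E"
      by (rule orthonormal_complement[OF subspace_span]) blast
    have "0 < CARD('n)" and "DIM(real^'p) = CARD('p)" by simp_all
    with le card_S have cardE: "card E = ?d"
      unfolding cardE dimU by arith
    have E_row: "restr S (A $ m) \<bullet> e = 0" if "m \<noteq> i" "e \<in> E" for m e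
    proof -
      have "f (Inl m) \<in> span (f ` K)" using that by (intro span_base imageI) (auto simp: K_def)
      from EU[OF that(2) this] show ?thesis by (simp add: f_def)
    qed
    have E_axis: "e $ k = 0" if "k \<notin> S" "e \<in> E" for k e
    proof -
      have "f (Inr k) \<in> span (f ` K)" using that by (intro span_base imageI) (auto simp: K_def)
      from EU[OF that(2) this] show ?thesis by (simp add: f_def inner_axis')
    qed
    have E_restr: "restr S x \<bullet> e = x \<bullet> e" if "e \<in> E" for x e
      using E_axis[OF _ that] inner_restr[of S e x] by (simp add: inner_commute)
    have "AE B in std_gaussian. ennreal (cramer_inv (row_gram S (N A B)) $ i $ i)
        = inverse (ennreal (\<Sum>e\<in>E. (B $ i \<bullet> e)\<^sup>2))"
      using AE
    proof eventually_elim
      case (elim B)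
      let ?R = "cramer_inv (row_gram S (N A B))"
      let ?w = "\<Sum>m\<in>UNIV. ?R $ i $ m *\<^sub>R restr S (N A B $ m)"
      have w_axis: "?w \<bullet> axis k 1 = 0" if "k \<notin> S" for k
        using that by (simp add: inner_sum_left restr_axis)
      have w_restr: "?w \<bullet> restr S x = ?w \<bullet> x" for x
        using w_axis by (intro inner_restr) (simp add: inner_axis)
      show ?case
      \<comment> \<open>\<open>?w\<close> is the dual vector of the new row. It uses the inverse
        Gram matrix of the resampled \<open>N A B\<close>, whereas \<open>E\<close> was built from
        the rows of \<open>A\<close> that resampling keeps.\<close>
      proof (rule inverse_gram_entry[OF E, where w="?w"])
        show "(?w - ?R $ i $ i *\<^sub>R B $ i) \<bullet> e = 0" if "e \<in> E" for e
        proof -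
          have "?w \<bullet> e = (\<Sum>m\<in>UNIV. if m = i then ?R $ i $ i * (B $ i \<bullet> e) else 0)"
            unfolding inner_sum_left
            by (intro sum.cong) (auto simp: N_nth E_row[OF _ that, unfolded E_restr[OF that]] E_restr[OF that])
          then show ?thesis by (simp add: inner_diff_left)
        qed
        show "?w \<in> span E"
        proof (rule spanE, rule inner_span_eq_0[where F="f ` K"])
          fix x assume "x \<in> f ` K"
          then consider j where "j \<noteq> i" "x = restr S (A $ j)" | k where "k \<notin> S" "x = axis k 1"
            unfolding K_def f_def by fastforce
          then show "x \<bullet> ?w = 0"
          proof cases
            case 1
            then show ?thesis
              using row_dual_inner[OF elim, of i j] by (simp add: N_nth inner_commute)
          next
            case 2
            then show ?thesis using w_axis by (simp add: inner_commute)
          qed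
        qed auto
        show "?w \<bullet> B $ i = 1"
          using row_dual_inner[OF elim, of i i] by (subst w_restr[symmetric]) (simp add: N_nth)
      qed
    qed
    then have "(\<integral>\<^sup>+B. ennreal (cramer_inv (row_gram S (N A B)) $ i $ i) \<partial>std_gaussian)
        = (\<integral>\<^sup>+B. inverse (ennreal (\<Sum>e\<in>E. (B $ i \<bullet> e)\<^sup>2)) \<partial>(std_gaussian :: (real^'p^'n) measure))"
      by (rule nn_integral_cong_AE)
    also have "\<dots> = (if 2 < card E then ennreal (1 / (real (card E) - 2)) else \<infinity>)"
      by (rule nn_integral_std_gaussian_inverse_chi_square_isometry[OF E(1,2), where emb="axis i"])
         (auto simp: inner_axis_axis inner_axis)
    finally show ?thesis using cardE by simp
  qed
  have "(\<integral>\<^sup>+A. ennreal (cramer_inv (row_gram S A) $ i $ i) \<partial>(std_gaussian :: (real^'p^'n) measure))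
      = (\<integral>\<^sup>+A. (\<integral>\<^sup>+B. ennreal (cramer_inv (row_gram S (N A B)) $ i $ i) \<partial>std_gaussian) \<partial>std_gaussian)"
    unfolding N_def by (rule nn_integral_std_gaussian_resample[OF Q, symmetric]) measurable
  also have "\<dots> = (\<integral>\<^sup>+A. (if 2 < ?d then ennreal (1 / (real ?d - 2)) else \<infinity>) \<partial>(std_gaussian :: (real^'p^'n) measure))"
  proof (rule nn_integral_cong_AE)
    have "AE A in (std_gaussian :: (real^'p^'n) measure). AE B in std_gaussian. det (row_gram S (N A B)) \<noteq> 0"
      unfolding N_def by (rule AE_std_gaussian_resample[OF Q]) (use AE_det_row_gram[OF le] in auto)
    with AE_det_row_gram[OF le]
    show "AE A in (std_gaussian :: (real^'p^'n) measure). (\<integral>\<^sup>+B. ennreal (cramer_inv (row_gram S (N A B)) $ i $ i) \<partial>std_gaussian)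
      = (if 2 < ?d then ennreal (1 / (real ?d - 2)) else \<infinity>)"
      by eventually_elim (rule main)
  qed
  also have "\<dots> = (if 2 < ?d then ennreal (1 / (real ?d - 2)) else \<infinity>)"
    using std_gaussian.emeasure_space_1[where 'a="real^'p^'n"] by simp
  also have "\<dots> = (if CARD('n) + 1 < card S then ennreal (1 / (real (card S) - real CARD('n) - 1)) else \<infinity>)"
    \<comment> \<open>The condition \<open>2 < ?d\<close> is \<open>CARD('n) + 1 < card S\<close>,
      and \<open>?d - 2\<close> is the denominator \<open>card S - CARD('n) - 1\<close>.\<close>
    using le by (auto simp: of_nat_diff)
  finally show ?thesis .
qed

text \<open>The same argument with column \<open>k\<close> resampled: the other
  \<open>card S - 1\<close> columns in \<open>S\<close> are independent vectors of length
  \<open>n\<close>, which leaves \<open>n - card S + 1\<close> degrees of freedom.\<close>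

lemma nn_integral_cramer_inv_col_gram:
  fixes S :: "'p::finite set"
  assumes le: "card S \<le> CARD('n)" and k: "k \<in> S"
  shows "(\<integral>\<^sup>+A. ennreal (cramer_inv (col_gram S A) $ k $ k) \<partial>(std_gaussian :: (real^'p^'n) measure))
       = (if card S + 1 < CARD('n) then ennreal (1 / (real CARD('n) - real (card S) - 1)) else \<infinity>)"
proof -
  define Q :: "real^'p^'n \<Rightarrow> real^'p^'n" where "Q A = (\<chi> i l. if l = k then A $ i $ l else 0)" for A
  have Q: "linear Q" "\<And>A. Q (Q A) = Q A" "\<And>A B. Q A \<bullet> B = A \<bullet> Q B"
    by (auto simp: Q_def linear_iff vec_eq_iff inner_vec_def intro!: sum.cong)
  define N where "N A B = A - Q A + Q B" for A B
  have N_col: "column m (N A B) = (if m = k then column k B else column m A)" for A B m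
    by (simp add: N_def Q_def column_def vec_eq_iff)
  let ?d = "CARD('n) - card S + 1"
  have card_S: "0 < card S" using k by (auto simp: card_gt_0_iff)
  have main: "(\<integral>\<^sup>+B. ennreal (cramer_inv (col_gram S (N A B)) $ k $ k) \<partial>std_gaussian)
      = (if 2 < ?d then ennreal (1 / (real ?d - 2)) else \<infinity>)"
    if A: "det (col_gram S A) \<noteq> 0" and AE: "AE B in std_gaussian. det (col_gram S (N A B)) \<noteq> 0" for A
  proof -
    let ?U = "span ((\<lambda>l. column l A) ` (S - {k}))"
    have "dim ?U = card (S - {k})"
      by (rule dim_span_dual_family[where w="\<lambda>l. \<Sum>m\<in>S. cramer_inv (col_gram S A) $ l $ m *\<^sub>R column m A"])
         (auto simp: col_dual_inner[OF A])
    then have dimU: "dim ?U = card S - 1" using k by simp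
    obtain E where E: "pairwise orthogonal E" "\<And>e. e \<in> E \<Longrightarrow> norm e = 1" "finite E"
      and cardE: "card E = DIM(real^'n) - dim ?U"
      and EU: "\<And>e u. e \<in> E \<Longrightarrow> u \<in> ?U \<Longrightarrow> u \<bullet> e = 0"
      and spanE: "\<And>w. (\<And>u. u \<in> ?U \<Longrightarrow> u \<bullet> w = 0) \<Longrightarrow> w \<in> span E"
      by (rule orthonormal_complement[OF subspace_span]) blast
    have cardE: "card E = ?d"
      using cardE dimU le card_S by simp
    have E_col: "column m A \<bullet> e = 0" if "m \<in> S" "m \<noteq> k" "e \<in> E" for m e
      using that by (intro EU span_base imageI) auto
    have "AE B in std_gaussian. ennreal (cramer_inv (col_gram S (N A B)) $ k $ k)
        = inverse (ennreal (\<Sum>e\<in>E. (column k B \<bullet> e)\<^sup>2))"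
      using AE
    proof eventually_elim
      case (elim B)
      let ?R = "cramer_inv (col_gram S (N A B))"
      let ?w = "\<Sum>m\<in>S. ?R $ k $ m *\<^sub>R column m (N A B)"
      show ?case
      proof (rule inverse_gram_entry[OF E, where w="?w"])
        show "(?w - ?R $ k $ k *\<^sub>R column k B) \<bullet> e = 0" if "e \<in> E" for e
        proof -
          have "?w \<bullet> e = (\<Sum>m\<in>S. if m = k then ?R $ k $ k * (column k B \<bullet> e) else 0)"
            unfolding inner_sum_left
            by (intro sum.cong) (auto simp: N_col E_col[OF _ _ that])
          then show ?thesis using k by (simp add: inner_diff_left)
        qed
        show "?w \<in> span E"
        proof (rule spanE, rule inner_span_eq_0[where F="(\<lambda>l. column l A) ` (S - {k})"])
          fix x assume "x \<in> (\<lambda>l. column l A) ` (S - {k})"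
          then obtain l where l: "l \<in> S" "l \<noteq> k" "x = column l A" by auto
          then show "x \<bullet> ?w = 0"
            using col_dual_inner[OF elim, of l k] by (simp add: N_col inner_commute)
        qed auto
        show "?w \<bullet> column k B = 1"
          using col_dual_inner[OF elim, of k k] k by (simp add: N_col)
      qed
    qed
    then have "(\<integral>\<^sup>+B. ennreal (cramer_inv (col_gram S (N A B)) $ k $ k) \<partial>std_gaussian)
        = (\<integral>\<^sup>+B. inverse (ennreal (\<Sum>e\<in>E. (column k B \<bullet> e)\<^sup>2)) \<partial>(std_gaussian :: (real^'p^'n) measure))"
      by (rule nn_integral_cong_AE)
    also have "\<dots> = (if 2 < card E then ennreal (1 / (real (card E) - 2)) else \<infinity>)"
      \<comment> \<open>The embedding places \<open>e\<close> in column \<open>k\<close> of a matrix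
        that is otherwise zero.\<close>
      by (rule nn_integral_std_gaussian_inverse_chi_square_isometry[OF E(1,2), where emb="\<lambda>e. \<chi> i. axis k (e $ i)"])
         (auto simp: inner_vec_def[where 'b='n] inner_axis_axis inner_axis column_def)
    finally show ?thesis using cardE by simp
  qed
  have "(\<integral>\<^sup>+A. ennreal (cramer_inv (col_gram S A) $ k $ k) \<partial>(std_gaussian :: (real^'p^'n) measure))
      = (\<integral>\<^sup>+A. (\<integral>\<^sup>+B. ennreal (cramer_inv (col_gram S (N A B)) $ k $ k) \<partial>std_gaussian) \<partial>std_gaussian)"
    unfolding N_def by (rule nn_integral_std_gaussian_resample[OF Q, symmetric]) measurable
  also have "\<dots> = (\<integral>\<^sup>+A. (if 2 < ?d then ennreal (1 / (real ?d - 2)) else \<infinity>) \<partial>(std_gaussian :: (real^'p^'n) measure))"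
  proof (rule nn_integral_cong_AE)
    have "AE A in (std_gaussian :: (real^'p^'n) measure). AE B in std_gaussian. det (col_gram S (N A B)) \<noteq> 0"
      unfolding N_def by (rule AE_std_gaussian_resample[OF Q]) (use AE_det_col_gram[OF le] in auto)
    with AE_det_col_gram[OF le]
    show "AE A in (std_gaussian :: (real^'p^'n) measure). (\<integral>\<^sup>+B. ennreal (cramer_inv (col_gram S (N A B)) $ k $ k) \<partial>std_gaussian)
      = (if 2 < ?d then ennreal (1 / (real ?d - 2)) else \<infinity>)"
      by eventually_elim (rule main)
  qed
  also have "\<dots> = (if 2 < ?d then ennreal (1 / (real ?d - 2)) else \<infinity>)"
    using std_gaussian.emeasure_space_1[where 'a="real^'p^'n"] by simp
  also have "\<dots> = (if card S + 1 < CARD('n) then ennreal (1 / (real CARD('n) - real (card S) - 1)) else \<infinity>)"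
    using le by (auto simp: of_nat_diff)
  finally show ?thesis .
qed

section \<open>Gaussian matrices and multiplication by orthogonal matrices\<close>

lemma gaussian_matrix_eq: "gaussian_matrix = (std_gaussian :: (real^'p^'n) measure)"
proof -
  have row: "(\<Prod>j\<in>UNIV. std_normal_density (x $ j)) = (\<Prod>b\<in>Basis. std_normal_density (x \<bullet> b))"
    for x :: "real^'p"
  proof -
    have "(norm x)\<^sup>2 = (\<Sum>j\<in>UNIV. (x $ j)\<^sup>2)"
      by (simp only: power2_norm_eq_inner inner_vec_def) (simp add: power2_eq_square)
    then show ?thesis
      by (subst prod_std_normal_density_eq)
         (simp only: std_normal_density_def prod.distrib prod_constant exp_sum[OF finite, symmetric],
          simp add: sum_divide_distrib sum_negf)
  qed
  have "(norm A)\<^sup>2 = (\<Sum>i\<in>UNIV. (norm (A $ i))\<^sup>2)" for A :: "real^'p^'n"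
    by (simp only: power2_norm_eq_inner inner_vec_def)
  then have "(\<Prod>i\<in>UNIV. \<Prod>j\<in>UNIV. std_normal_density (A $ i $ j))
      = (\<Prod>b\<in>Basis. std_normal_density (A \<bullet> b))" for A :: "real^'p^'n"
    by (simp only: row prod_std_normal_density_eq prod.distrib prod_constant exp_sum[OF finite, symmetric])
       (simp add: sum_divide_distrib sum_negf mult.commute flip: power_mult)
  then show ?thesis
    by (simp add: gaussian_matrix_def std_gaussian_def)
qed

lemma inner_matrix_trace: "A \<bullet> B = trace (transpose A ** (B :: real^'p^'n))"
  unfolding inner_vec_def trace_def matrix_matrix_mult_def transpose_def
  by (simp, rule sum.swap)

lemma linear_matrix_mult_left: "linear (\<lambda>A :: real^'p^'n. U ** A)"
  by (intro linearI) (simp_all add: vec_eq_iff matrix_matrix_mult_def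
      sum_distrib_left distrib_left sum.distrib mult_ac)

lemma linear_matrix_mult_right: "linear (\<lambda>A :: real^'p^'n. A ** (U :: real^'p^'p))"
  by (intro linearI) (simp_all add: vec_eq_iff matrix_matrix_mult_def
      sum_distrib_left distrib_right sum.distrib mult.assoc)

lemma orthogonal_transformation_matrix_mult_left:
  assumes "orthogonal_matrix U"
  shows "orthogonal_transformation (\<lambda>A :: real^'p^'n. U ** A)"
proof -
  have "(U ** A) \<bullet> (U ** B) = A \<bullet> B" for A B :: "real^'p^'n"
  proof -
    have "transpose (U ** A) ** (U ** B) = transpose A ** (transpose U ** U) ** B"
      by (simp only: matrix_transpose_mul matrix_mul_assoc)
    then show ?thesis
      using assms by (simp add: inner_matrix_trace orthogonal_matrix_def)
  qed
  then show ?thesis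
    by (simp add: orthogonal_transformation_def linear_matrix_mult_left)
qed

lemma orthogonal_transformation_matrix_mult_right:
  assumes "orthogonal_matrix U"
  shows "orthogonal_transformation (\<lambda>A :: real^'p^'n. A ** U)"
proof -
  have "(A ** U) \<bullet> (B ** U) = A \<bullet> B" for A B :: "real^'p^'n"
  proof -
    have "B ** U ** transpose (A ** U) = B ** (U ** transpose U) ** transpose A"
      by (simp only: matrix_transpose_mul matrix_mul_assoc)
    then show ?thesis
      using assms by (simp add: inner_matrix_trace trace_mul_sym[of "transpose _"] orthogonal_matrix_def)
  qed
  then show ?thesis
    by (simp add: orthogonal_transformation_def linear_matrix_mult_right)
qed

lemma borel_measurable_trace [measurable (raw)]:
  fixes f :: "'a \<Rightarrow> real^'n^'n"
  assumes [measurable]: "f \<in> borel_measurable M"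
  shows "(\<lambda>x. trace (f x)) \<in> borel_measurable M"
  unfolding trace_def by measurable

lemma pred_is_pinv [measurable (raw)]:
  fixes f :: "'a \<Rightarrow> real^'p^'n"
  assumes [measurable]: "f \<in> borel_measurable M" "g \<in> borel_measurable M"
  shows "Measurable.pred M (\<lambda>x. is_pinv (f x) (g x))"
  unfolding is_pinv_def by measurable

lemma cols_cols: "cols S (cols S A) = cols S A"
  by (simp add: cols_def vec_eq_iff)

lemma row_gram_cols: "row_gram S (cols S A) = row_gram S A"
  by (simp add: row_gram_def cols_cols)

lemma col_gram_cols: "col_gram S (cols S A) = col_gram S A"
  by (simp add: col_gram_def cols_cols)

text \<open>Unifies independent rows and independent columns, so that later arguments need no case
  split. The identity \<open>W (cols S A) = W A\<close> expresses that the estimator does not see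
  the columns outside \<open>S\<close>.\<close>

lemma gaussian_pinv_exists:
  fixes S :: "'p::finite set"
  assumes "S \<noteq> {}"
  obtains W :: "real^'p^'n \<Rightarrow> real^'n^'p" where
    "W \<in> borel_measurable borel"
    "\<And>A. W (cols S A) = W A"
    "AE A in std_gaussian. is_pinv (cols S A) (W A)"
    "AE A in std_gaussian. trace (W A ** cols S A) = real (min (card S) CARD('n))"
    "(\<integral>\<^sup>+A. ennreal (trace (transpose (W A) ** W A)) \<partial>std_gaussian) = gamma_S (card S) CARD('n)"
proof (cases "CARD('n) \<le> card S")
  case True
  define W :: "real^'p^'n \<Rightarrow> real^'n^'p" where
    "W A = transpose (cols S A) ** cramer_inv (row_gram S A)" for A
  note AE = AE_det_row_gram[OF True]
  have "AE A in (std_gaussian :: (real^'p^'n) measure).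
      ennreal (trace (transpose (W A) ** W A)) = (\<Sum>i\<in>UNIV. ennreal (cramer_inv (row_gram S A) $ i $ i))"
    using AE
  proof eventually_elim
    case (elim A)
    have "trace (transpose (W A) ** W A) = (\<Sum>i\<in>UNIV. cramer_inv (row_gram S A) $ i $ i)"
      unfolding W_def trace_gram_row[OF elim] by (simp add: trace_def)
    then show ?case
      by (simp add: sum_ennreal cramer_inv_row_gram_nonneg[OF elim])
  qed
  then have "(\<integral>\<^sup>+A. ennreal (trace (transpose (W A) ** W A)) \<partial>std_gaussian)
      = (\<integral>\<^sup>+A. (\<Sum>i\<in>UNIV. ennreal (cramer_inv (row_gram S A) $ i $ i)) \<partial>(std_gaussian :: (real^'p^'n) measure))"
    by (rule nn_integral_cong_AE)
  also have "\<dots> = (\<Sum>i\<in>(UNIV :: 'n set). if CARD('n) + 1 < card S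
      then ennreal (1 / (real (card S) - real CARD('n) - 1)) else \<infinity>)"
    by (subst nn_integral_sum) (simp_all add: nn_integral_cramer_inv_row_gram[OF True])
  also have "\<dots> = gamma_S (card S) CARD('n)"
    using True by (auto simp: gamma_S_def ennreal_of_nat_eq_real_of_nat ennreal_mult_top ennreal_mult[symmetric])
  finally have int: "(\<integral>\<^sup>+A. ennreal (trace (transpose (W A) ** W A)) \<partial>std_gaussian) = gamma_S (card S) CARD('n)" .
  show ?thesis
  proof (rule that[OF _ _ _ _ int])
    show "W \<in> borel_measurable borel" unfolding W_def by measurable
    show "W (cols S A) = W A" for A by (simp add: W_def cols_cols row_gram_cols)
    show "AE A in std_gaussian. is_pinv (cols S A) (W A)"
      using AE by eventually_elim (simp add: W_def is_pinv_row)
    show "AE A in std_gaussian. trace (W A ** cols S A) = real (min (card S) CARD('n))"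
      using AE by eventually_elim (use True in \<open>simp add: W_def trace_mul_row min_absorb2\<close>)
  qed
next
  case False
  then have le: "card S \<le> CARD('n)" by simp
  define W :: "real^'p^'n \<Rightarrow> real^'n^'p" where
    "W A = cramer_inv (col_gram S A) ** transpose (cols S A)" for A
  note AE = AE_det_col_gram[OF le]
  have "AE A in (std_gaussian :: (real^'p^'n) measure).
      ennreal (trace (transpose (W A) ** W A)) = (\<Sum>k\<in>S. ennreal (cramer_inv (col_gram S A) $ k $ k))"
    using AE
  proof eventually_elim
    case (elim A)
    have "trace (transpose (W A) ** W A) = (\<Sum>k\<in>S. cramer_inv (col_gram S A) $ k $ k)"
      unfolding W_def by (rule trace_gram_col[OF elim])
    then show ?case
      by (simp add: sum_ennreal cramer_inv_col_gram_nonneg[OF elim])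
  qed
  then have "(\<integral>\<^sup>+A. ennreal (trace (transpose (W A) ** W A)) \<partial>std_gaussian)
      = (\<integral>\<^sup>+A. (\<Sum>k\<in>S. ennreal (cramer_inv (col_gram S A) $ k $ k)) \<partial>(std_gaussian :: (real^'p^'n) measure))"
    by (rule nn_integral_cong_AE)
  also have "\<dots> = (\<Sum>k\<in>S. if card S + 1 < CARD('n)
      then ennreal (1 / (real CARD('n) - real (card S) - 1)) else \<infinity>)"
    by (subst nn_integral_sum) (simp_all add: nn_integral_cramer_inv_col_gram[OF le])
  also have "\<dots> = gamma_S (card S) CARD('n)"
    \<comment> \<open>\<open>S \<noteq> {}\<close> ensures that infinite terms give an infinite sum;
      in the finite case the \<open>card S\<close> equal terms supply the numerator of
      \<open>gamma_S\<close>.\<close>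
    using False assms by (auto simp: gamma_S_def ennreal_of_nat_eq_real_of_nat ennreal_mult_top ennreal_mult[symmetric])
  finally have int: "(\<integral>\<^sup>+A. ennreal (trace (transpose (W A) ** W A)) \<partial>std_gaussian) = gamma_S (card S) CARD('n)" .
  show ?thesis
  proof (rule that[OF _ _ _ _ int])
    show "W \<in> borel_measurable borel" unfolding W_def by measurable
    show "W (cols S A) = W A" for A by (simp add: W_def cols_cols col_gram_cols)
    show "AE A in std_gaussian. is_pinv (cols S A) (W A)"
      using AE by eventually_elim (simp add: W_def is_pinv_col)
    show "AE A in std_gaussian. trace (W A ** cols S A) = real (min (card S) CARD('n))"
      using AE by eventually_elim (use le in \<open>simp add: W_def trace_mul_col min_absorb1\<close>)
  qed
qed

section \<open>The mean squared error\<close>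

lemma norm_axis: "norm (axis i x) = norm (x :: 'a::real_inner)"
  by (simp add: norm_eq_sqrt_inner inner_axis_axis)

lemma restr_idem [simp]: "restr S (restr S x) = restr S x"
  by (simp add: restr_def vec_eq_iff)

lemma restr_axis_in: "k \<in> S \<Longrightarrow> restr S (axis k c) = axis k c"
  by (auto simp: restr_def axis_def vec_eq_iff)

lemma norm_restr: "(norm (restr S x))\<^sup>2 = (\<Sum>k\<in>S. (x $ k)\<^sup>2)"
proof -
  have "(norm (restr S x))\<^sup>2 = (\<Sum>k\<in>UNIV. if k \<in> S then (x $ k)\<^sup>2 else 0)"
    unfolding power2_norm_eq_inner inner_vec_def
    by (intro sum.cong) (auto simp: restr_def power2_eq_square)
  then show ?thesis by (simp add: sum.If_cases)
qed

lemma cols_mult_restr: "cols S A *v restr S x = cols S A *v x"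
  by (simp add: cols_def restr_def matrix_vector_mult_def vec_eq_iff) (auto intro!: sum.cong)

lemma cols_mult_eq: "(cols S A *v x) $ i = A $ i \<bullet> restr S x"
  by (auto simp: cols_def restr_def matrix_vector_mult_def inner_vec_def intro!: sum.cong)

lemma cols_compl_add: "cols S A + cols (- S) A = A"
  by (simp add: cols_def vec_eq_iff)

text \<open>A reflection in a vector supported on \<open>S\<close> acts only on the coordinates in
  \<open>S\<close>; multiplying by it on the right therefore commutes with taking
  \<open>cols S\<close>.\<close>

lemma householder_diag_S:
  assumes "restr S d = d"
  shows "householder d ** diag_S S = diag_S S ** householder d"
proof -
  have "d \<bullet> restr S x = restr S d \<bullet> x" for x
    by (auto simp: restr_def inner_vec_def intro!: sum.cong)
  moreover have "restr S (x - c *\<^sub>R d) = restr S x - c *\<^sub>R restr S d" for x c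
    by (simp add: restr_def vec_eq_iff)
  ultimately show ?thesis
    using assms by (simp add: matrix_eq householder_mult flip: matrix_vector_mul_assoc)
qed

text \<open>\<open>W y\<close> lies in the range of the transposed \<open>cols S A\<close>, so it
  vanishes outside \<open>S\<close>, and the sum over \<open>S\<close> is a full Euclidean
  norm.\<close>

lemma sq_err_S_eq:
  assumes "is_pinv (cols S A) W"
  shows "sq_err_S S A x v = (norm (restr S x - W *v (A *v x + v)))\<^sup>2"
proof -
  let ?B = "cols S A" and ?y = "A *v x + v"
  let ?z = "(transpose W ** W) *v ?y"
  have pinv: "mp_pinv (gram_S S A) = transpose W ** W"
    unfolding gram_S_eq row_gram_def using is_pinv_gram[OF assms] by (rule mp_pinv_eqI)
  have Wy: "W *v ?y = transpose ?B *v ?z"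
    by (simp only: matrix_vector_mul_assoc is_pinv_transpose_mul[OF assms])
  have nth: "(transpose ?B *v z) $ k = (if k \<in> S then \<Sum>i\<in>UNIV. A $ i $ k * z $ i else 0)" for z k
    by (simp add: matrix_vector_mult_def transpose_def cols_def)
  have "restr S x - W *v ?y = restr S (\<chi> k. x $ k - WS_apply S A ?y k)"
    unfolding Wy vec_eq_iff
    by (simp only: vector_minus_component nth) (simp add: restr_def WS_apply_def pinv)
  then show ?thesis
    by (simp add: norm_restr sq_err_S_def)
qed

text \<open>An orthogonal \<open>U\<close> taking \<open>u\<close> to \<open>norm u\<close> times
  axis \<open>i\<close> preserves the law of \<open>A\<close> under left multiplication and changes
  \<open>W\<close> to \<open>W\<close> times the transpose of \<open>U\<close>. So the mean depends
  on \<open>u\<close> through its norm only, and averaging over the axes gives the trace divided by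
  \<open>n\<close>.\<close>

lemma nn_integral_pinv_mult:
  fixes W :: "real^'p^'n \<Rightarrow> real^'n^'p" and u :: "real^'n"
  assumes [measurable]: "W \<in> borel_measurable borel"
    and AE: "AE A in std_gaussian. is_pinv (cols S A) (W A)"
  shows "(\<integral>\<^sup>+A. ennreal ((norm (W A *v u))\<^sup>2) \<partial>std_gaussian)
       = ennreal ((norm u)\<^sup>2 / real CARD('n)) * (\<integral>\<^sup>+A. ennreal (trace (transpose (W A) ** W A)) \<partial>std_gaussian)"
proof -
  let ?I = "\<integral>\<^sup>+A. ennreal ((norm (W A *v u))\<^sup>2) \<partial>std_gaussian"
  have I: "?I = ennreal ((norm u)\<^sup>2) * (\<integral>\<^sup>+A. ennreal ((norm (W A *v axis i 1))\<^sup>2) \<partial>std_gaussian)" for i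
  proof -
    define U where "U = householder (u - norm u *\<^sub>R axis i 1)"
    have U: "orthogonal_matrix U" unfolding U_def by (rule orthogonal_matrix_householder)
    have Uu: "U *v u = norm u *\<^sub>R axis i 1"
      unfolding U_def by (rule householder_swap) (simp add: norm_axis)
    have T: "orthogonal_transformation (\<lambda>A :: real^'p^'n. U ** A)"
      by (rule orthogonal_transformation_matrix_mult_left[OF U])
    have "?I = (\<integral>\<^sup>+A. ennreal ((norm (W (U ** A) *v u))\<^sup>2) \<partial>std_gaussian)"
      by (rule nn_integral_std_gaussian_orthogonal_transformation[OF T, symmetric]) measurable
    also have "\<dots> = (\<integral>\<^sup>+A. ennreal ((norm u)\<^sup>2) * ennreal ((norm (W A *v axis i 1))\<^sup>2) \<partial>std_gaussian)"
    proof (rule nn_integral_cong_AE)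
      \<comment> \<open>\<open>W\<close> is a pseudoinverse only almost everywhere, so the property
        is transported to \<open>U ** A\<close> before uniqueness can identify
        \<open>W (U ** A)\<close>.\<close>
      have "AE A in std_gaussian. is_pinv (cols S (U ** A)) (W (U ** A))"
        by (rule AE_std_gaussian_orthogonal_transformation[OF T _ AE]) measurable
      with AE show "AE A in std_gaussian. ennreal ((norm (W (U ** A) *v u))\<^sup>2)
          = ennreal ((norm u)\<^sup>2) * ennreal ((norm (W A *v axis i 1))\<^sup>2)"
      proof eventually_elim
        case (elim A)
        have "is_pinv (cols S (U ** A)) (W A ** transpose U)"
          using is_pinv_orthogonal_left[OF elim(1) U] by (simp add: cols_eq matrix_mul_assoc)
        then have "W (U ** A) = W A ** transpose U"
          by (rule is_pinv_unique[OF elim(2)])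
        then have "W (U ** A) *v u = norm u *\<^sub>R (W A *v axis i 1)"
          using Uu by (simp add: U_def transpose_householder matrix_vector_mult_scaleR
              flip: matrix_vector_mul_assoc)
        then show ?case
          by (simp add: power_mult_distrib ennreal_mult)
      qed
    qed
    also have "\<dots> = ennreal ((norm u)\<^sup>2) * (\<integral>\<^sup>+A. ennreal ((norm (W A *v axis i 1))\<^sup>2) \<partial>std_gaussian)"
      by (rule nn_integral_cmult) measurable
    finally show ?thesis .
  qed
  have "of_nat CARD('n) * ?I = (\<Sum>i\<in>(UNIV :: 'n set). ?I)" by simp
  also have "\<dots> = (\<Sum>i\<in>UNIV. ennreal ((norm u)\<^sup>2) * (\<integral>\<^sup>+A. ennreal ((norm (W A *v axis i 1))\<^sup>2) \<partial>std_gaussian))"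
    by (intro sum.cong refl I)
  also have "\<dots> = ennreal ((norm u)\<^sup>2) * (\<integral>\<^sup>+A. (\<Sum>i\<in>UNIV. ennreal ((norm (W A *v axis i 1))\<^sup>2)) \<partial>std_gaussian)"
    by (subst nn_integral_sum) (simp_all add: sum_distrib_left)
  also have "\<dots> = ennreal ((norm u)\<^sup>2) * (\<integral>\<^sup>+A. ennreal (trace (transpose (W A) ** W A)) \<partial>std_gaussian)"
    by (simp add: sum_ennreal flip: sum_norm_matrix_axis)
  finally have "ennreal (1 / real CARD('n)) * (of_nat CARD('n) * ?I)
      = ennreal (1 / real CARD('n)) * (ennreal ((norm u)\<^sup>2) * (\<integral>\<^sup>+A. ennreal (trace (transpose (W A) ** W A)) \<partial>std_gaussian))"
    by simp
  then show ?thesis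
    by (simp add: ennreal_of_nat_eq_real_of_nat mult.assoc[symmetric] ennreal_mult[symmetric])
qed

text \<open>The mean is again reduced to axes, now by right multiplication. For the projection
  \<open>P\<close>, the sum over \<open>k\<close> in \<open>S\<close> of
  \<open>1 - P $ k $ k\<close> is \<open>card S - r\<close>, and dividing by \<open>card S\<close>
  gives the factor.\<close>

lemma nn_integral_pinv_residual:
  fixes W :: "real^'p^'n \<Rightarrow> real^'n^'p" and x :: "real^'p"
  assumes [measurable]: "W \<in> borel_measurable borel"
    and AE: "AE A in std_gaussian. is_pinv (cols S A) (W A)"
    and AE_trace: "AE A in std_gaussian. trace (W A ** cols S A) = r"
    and r: "r \<le> real (card S)" and S: "S \<noteq> {}" and x: "restr S x = x"
  shows "(\<integral>\<^sup>+A. ennreal ((norm (x - (W A ** cols S A) *v x))\<^sup>2) \<partial>std_gaussian)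
       = ennreal ((norm x)\<^sup>2 * (1 - r / real (card S)))"
proof -
  have cS: "0 < card S" using S by (simp add: card_gt_0_iff)
  let ?I = "\<integral>\<^sup>+A. ennreal ((norm (x - (W A ** cols S A) *v x))\<^sup>2) \<partial>std_gaussian"
  let ?J = "\<lambda>k. \<integral>\<^sup>+A. ennreal ((norm (axis k 1 - (W A ** cols S A) *v axis k 1))\<^sup>2) \<partial>std_gaussian"
  have I: "?I = ennreal ((norm x)\<^sup>2) * ?J k" if k: "k \<in> S" for k
  proof -
    define d where "d = x - norm x *\<^sub>R axis k 1"
    define U where "U = householder d"
    have "restr S d = restr S x - norm x *\<^sub>R restr S (axis k 1)"
      by (simp add: d_def restr_def vec_eq_iff)
    \<comment> \<open>Both \<open>x\<close> and axis \<open>k\<close> are supported on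
      \<open>S\<close>, hence so is \<open>d\<close>, and the reflection respects
      \<open>cols S\<close>.\<close>
    then have d: "restr S d = d" using x k by (simp add: restr_axis_in d_def)
    have U: "orthogonal_matrix U" unfolding U_def by (rule orthogonal_matrix_householder)
    have UU: "U *v (U *v z) = z" for z unfolding U_def by (rule householder_involution)
    have Ux: "U *v x = norm x *\<^sub>R axis k 1"
      unfolding U_def d_def by (rule householder_swap) (simp add: norm_axis)
    have cols_U: "cols S (A ** U) = cols S A ** U" for A :: "real^'p^'n"
      using householder_diag_S[OF d] by (simp add: cols_eq U_def flip: matrix_mul_assoc)
    have norm_U: "norm (U *v z) = norm z" for z
      using U by (metis orthogonal_transformation_matrix orthogonal_transformation_norm
          matrix_of_matrix_vector_mul matrix_vector_mul_linear)
    have T: "orthogonal_transformation (\<lambda>A :: real^'p^'n. A ** U)"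
      by (rule orthogonal_transformation_matrix_mult_right[OF U])
    have "?I = (\<integral>\<^sup>+A. ennreal ((norm (x - (W (A ** U) ** cols S (A ** U)) *v x))\<^sup>2) \<partial>std_gaussian)"
      by (rule nn_integral_std_gaussian_orthogonal_transformation[OF T, symmetric]) measurable
    also have "\<dots> = (\<integral>\<^sup>+A. ennreal ((norm x)\<^sup>2) * ennreal ((norm (axis k 1 - (W A ** cols S A) *v axis k 1))\<^sup>2) \<partial>std_gaussian)"
    proof (rule nn_integral_cong_AE)
      have "AE A in std_gaussian. is_pinv (cols S (A ** U)) (W (A ** U))"
        by (rule AE_std_gaussian_orthogonal_transformation[OF T _ AE]) measurable
      with AE show "AE A in std_gaussian. ennreal ((norm (x - (W (A ** U) ** cols S (A ** U)) *v x))\<^sup>2)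
          = ennreal ((norm x)\<^sup>2) * ennreal ((norm (axis k 1 - (W A ** cols S A) *v axis k 1))\<^sup>2)"
      proof eventually_elim
        case (elim A)
        have "is_pinv (cols S (A ** U)) (transpose U ** W A)"
          using is_pinv_orthogonal_right[OF elim(1) U] by (simp add: cols_U)
        then have "W (A ** U) = U ** W A"
          using is_pinv_unique[OF elim(2)] by (simp add: U_def transpose_householder)
        then have "x - (W (A ** U) ** cols S (A ** U)) *v x = x - U *v ((W A ** cols S A) *v (U *v x))"
          by (simp only: cols_U matrix_vector_mul_assoc matrix_mul_assoc)
        also have "\<dots> = U *v (U *v x - (W A ** cols S A) *v (U *v x))"
          by (simp add: matrix_vector_mult_diff_distrib UU)
        also have "\<dots> = U *v (norm x *\<^sub>R (axis k 1 - (W A ** cols S A) *v axis k 1))"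
          by (simp add: Ux matrix_vector_mult_scaleR scaleR_diff_right)
        finally show ?case
          by (simp add: norm_U power_mult_distrib ennreal_mult)
      qed
    qed
    also have "\<dots> = ennreal ((norm x)\<^sup>2) * ?J k"
      by (rule nn_integral_cmult) measurable
    finally show ?thesis .
  qed
  have "of_nat (card S) * ?I = (\<Sum>k\<in>S. ?I)" by simp
  also have "\<dots> = (\<Sum>k\<in>S. ennreal ((norm x)\<^sup>2) * ?J k)"
    by (intro sum.cong refl I)
  also have "\<dots> = ennreal ((norm x)\<^sup>2) *
      (\<integral>\<^sup>+A. (\<Sum>k\<in>S. ennreal ((norm (axis k 1 - (W A ** cols S A) *v axis k 1))\<^sup>2)) \<partial>std_gaussian)"
    by (subst nn_integral_sum) (simp_all add: sum_distrib_left)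
  also have "(\<integral>\<^sup>+A. (\<Sum>k\<in>S. ennreal ((norm (axis k 1 - (W A ** cols S A) *v axis k 1))\<^sup>2)) \<partial>std_gaussian)
      = (\<integral>\<^sup>+A. ennreal (real (card S) - r) \<partial>(std_gaussian :: (real^'p^'n) measure))"
  proof (rule nn_integral_cong_AE)
    show "AE A in std_gaussian. (\<Sum>k\<in>S. ennreal ((norm (axis k 1 - (W A ** cols S A) *v axis k 1))\<^sup>2))
        = ennreal (real (card S) - r)"
      using AE AE_trace
    proof eventually_elim
      case (elim A)
      let ?P = "W A ** cols S A"
      have P: "?P ** ?P = ?P"
        by (simp add: is_pinvD(2,4)[OF elim(1)] flip: matrix_mul_assoc)
      have "?P $ k $ k = 0" if "k \<notin> S" for k
        using that by (simp add: matrix_matrix_mult_def cols_def)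
      then have "(\<Sum>k\<in>S. ?P $ k $ k) = trace ?P"
        unfolding trace_def by (intro sum.mono_neutral_left) auto
      then have "(\<Sum>k\<in>S. (norm (axis k 1 - ?P *v axis k 1))\<^sup>2) = real (card S) - r"
        using elim(2) by (simp add: norm_projection_residual_axis[OF is_pinvD(6)[OF elim(1)] P] sum_subtractf)
      then show ?case by (simp add: sum_ennreal)
    qed
  qed
  also have "\<dots> = ennreal (real (card S) - r)"
    using std_gaussian.emeasure_space_1[where 'a="real^'p^'n"] by simp
  finally have "ennreal (1 / real (card S)) * (of_nat (card S) * ?I)
      = ennreal (1 / real (card S)) * (ennreal ((norm x)\<^sup>2) * ennreal (real (card S) - r))"
    by simp
  then have "?I = ennreal (1 / real (card S) * ((norm x)\<^sup>2 * (real (card S) - r)))"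
    using S r by (simp add: ennreal_of_nat_eq_real_of_nat mult.assoc[symmetric] ennreal_mult[symmetric])
  also have "1 / real (card S) * ((norm x)\<^sup>2 * (real (card S) - r)) = (norm x)\<^sup>2 * (1 - r / real (card S))"
    using S by (simp add: right_diff_distrib diff_divide_distrib)
  finally show ?thesis .
qed

text \<open>Entry \<open>i\<close> is \<open>v $ i\<close> plus the inner product of
  \<open>B\<close> with the matrix carrying \<open>restr C x\<close> in row \<open>i\<close>, so
  each of the \<open>n\<close> entries contributes \<open>(norm (restr C x))^2\<close> plus
  \<open>(v $ i)^2\<close>.\<close>

lemma nn_integral_cols_mult:
  fixes x :: "real^'p" and v :: "real^'n"
  shows "(\<integral>\<^sup>+B. ennreal ((norm (cols C B *v x + v))\<^sup>2) \<partial>std_gaussian)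
       = ennreal (real CARD('n) * (norm (restr C x))\<^sup>2 + (norm v)\<^sup>2)"
proof -
  have "(norm (cols C B *v x + v))\<^sup>2 = (\<Sum>i\<in>UNIV. (B \<bullet> axis i (restr C x) + v $ i)\<^sup>2)" for B :: "real^'p^'n"
    by (simp only: power2_norm_eq_inner inner_vec_def[of "_ + _"])
       (simp add: cols_mult_eq inner_axis power2_eq_square)
  then have "(\<integral>\<^sup>+B. ennreal ((norm (cols C B *v x + v))\<^sup>2) \<partial>std_gaussian)
      = (\<integral>\<^sup>+B. (\<Sum>i\<in>UNIV. ennreal ((B \<bullet> axis i (restr C x) + v $ i)\<^sup>2)) \<partial>(std_gaussian :: (real^'p^'n) measure))"
    by (simp add: sum_ennreal)
  also have "\<dots> = (\<Sum>i\<in>UNIV. ennreal ((norm (axis i (restr C x) :: real^'p^'n))\<^sup>2 + (v $ i)\<^sup>2))"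
    by (subst nn_integral_sum) (simp_all only: nn_integral_std_gaussian_inner_square, measurable)
  also have "\<dots> = ennreal (real CARD('n) * (norm (restr C x))\<^sup>2 + (norm v)\<^sup>2)"
  proof -
    have "(norm v)\<^sup>2 = (\<Sum>i\<in>UNIV. (v $ i)\<^sup>2)"
      by (simp only: power2_norm_eq_inner inner_vec_def) (simp add: power2_eq_square)
    then show ?thesis
      by (subst sum_ennreal) (simp_all add: norm_axis sum.distrib)
  qed
  finally show ?thesis .
qed

lemma nn_integral_sq_err:
  fixes W :: "real^'p^'n \<Rightarrow> real^'n^'p" and x :: "real^'p" and v :: "real^'n"
  assumes W [measurable]: "W \<in> borel_measurable borel"
    and W_cols: "\<And>A. W (cols S A) = W A"
    and AE: "AE A in std_gaussian. is_pinv (cols S A) (W A)"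
    and AE_trace: "AE A in std_gaussian. trace (W A ** cols S A) = r"
    and r: "r \<le> real (card S)" and S: "S \<noteq> {}"
  shows "(\<integral>\<^sup>+A. ennreal ((norm (restr S x - W A *v (A *v x + v)))\<^sup>2) \<partial>std_gaussian)
       = ennreal ((norm (restr S x))\<^sup>2 * (1 - r / real (card S)))
         + (\<integral>\<^sup>+A. ennreal (trace (transpose (W A) ** W A)) \<partial>std_gaussian)
           * ennreal ((norm (restr (- S) x))\<^sup>2 + (norm v)\<^sup>2 / real CARD('n))"
proof -
  let ?T = "\<integral>\<^sup>+A. ennreal (trace (transpose (W A) ** W A)) \<partial>std_gaussian"
  have split: "A *v x + v = cols S A *v restr S x + (cols (- S) A *v x + v)" for A :: "real^'p^'n"
  proof -
    have "A *v x = (cols S A + cols (- S) A) *v x" by (simp only: cols_compl_add)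
    then show ?thesis
      by (simp add: matrix_vector_mult_add_rdistrib cols_mult_restr)
  qed
  have "(\<integral>\<^sup>+A. ennreal ((norm (restr S x - W A *v (A *v x + v)))\<^sup>2) \<partial>std_gaussian)
      = (\<integral>\<^sup>+A. ennreal ((norm (restr S x - (W A ** cols S A) *v restr S x))\<^sup>2)
               + ennreal ((norm (W A *v (cols (- S) A *v x + v)))\<^sup>2) \<partial>std_gaussian)"
  proof (rule nn_integral_cong_AE)
    show "AE A in std_gaussian. ennreal ((norm (restr S x - W A *v (A *v x + v)))\<^sup>2)
      = ennreal ((norm (restr S x - (W A ** cols S A) *v restr S x))\<^sup>2)
        + ennreal ((norm (W A *v (cols (- S) A *v x + v)))\<^sup>2)"
      using AE
    proof eventually_elim
      case (elim A)
      show ?case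
        by (subst split, subst norm_residual_pinv[OF elim]) simp
    qed
  qed
  also have "\<dots> = (\<integral>\<^sup>+A. ennreal ((norm (restr S x - (W A ** cols S A) *v restr S x))\<^sup>2) \<partial>std_gaussian)
               + (\<integral>\<^sup>+A. ennreal ((norm (W A *v (cols (- S) A *v x + v)))\<^sup>2) \<partial>std_gaussian)"
    by (rule nn_integral_add) measurable
  also have "(\<integral>\<^sup>+A. ennreal ((norm (restr S x - (W A ** cols S A) *v restr S x))\<^sup>2) \<partial>std_gaussian)
      = ennreal ((norm (restr S x))\<^sup>2 * (1 - r / real (card S)))"
    by (rule nn_integral_pinv_residual[OF W AE AE_trace r S]) simp
  also have "(\<integral>\<^sup>+A. ennreal ((norm (W A *v (cols (- S) A *v x + v)))\<^sup>2) \<partial>std_gaussian)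
      = (\<integral>\<^sup>+A. (\<integral>\<^sup>+B. ennreal ((norm (W A *v (cols (- S) B *v x + v)))\<^sup>2) \<partial>std_gaussian) \<partial>std_gaussian)"
  proof -
    have 1: "cols (- S) (A - cols (- S) A + cols (- S) B) = cols (- S) B" for A B :: "real^'p^'n"
      by (simp add: cols_def vec_eq_iff)
    have "cols S (A - cols (- S) A + cols (- S) B) = cols S A" for A B :: "real^'p^'n"
      by (simp add: cols_def vec_eq_iff)
    \<comment> \<open>This is the independence of \<open>W\<close> from the remaining columns:
      resampling them leaves it unchanged.\<close>
    then have 2: "W (A - cols (- S) A + cols (- S) B) = W A" for A B
      by (metis W_cols)
    have "linear (cols (- S) :: real^'p^'n \<Rightarrow> _)"
      by (intro linearI) (auto simp: cols_def vec_eq_iff)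
    moreover have "cols (- S) A \<bullet> B = A \<bullet> cols (- S) B" for A B :: "real^'p^'n"
      by (auto simp: cols_def inner_vec_def intro!: sum.cong)
    ultimately show ?thesis
      by (subst nn_integral_std_gaussian_resample[where Q="cols (- S)", symmetric])
         (auto simp: cols_cols 1 2)
  qed
  also have "\<dots> = (\<integral>\<^sup>+B. (\<integral>\<^sup>+A. ennreal ((norm (W A *v (cols (- S) B *v x + v)))\<^sup>2) \<partial>std_gaussian) \<partial>std_gaussian)"
  \<comment> \<open>With \<open>B\<close> fixed, the vector to which \<open>W A\<close> is applied
    is constant in \<open>A\<close>, as \<open>nn_integral_pinv_mult\<close> requires.\<close>
  proof (rule pair_sigma_finite.Fubini'[symmetric])
    show "pair_sigma_finite (std_gaussian :: (real^'p^'n) measure) (std_gaussian :: (real^'p^'n) measure)"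
      by (intro pair_sigma_finite.intro std_gaussian.sigma_finite_measure_axioms)
  qed measurable
  also have "\<dots> = (\<integral>\<^sup>+B. ennreal ((norm (cols (- S) B *v x + v))\<^sup>2) * (ennreal (1 / real CARD('n)) * ?T)
      \<partial>(std_gaussian :: (real^'p^'n) measure))"
    by (subst nn_integral_pinv_mult[OF W AE]) (simp add: ennreal_mult[symmetric] mult.assoc[symmetric])
  also have "\<dots> = ennreal (real CARD('n) * (norm (restr (- S) x))\<^sup>2 + (norm v)\<^sup>2) * (ennreal (1 / real CARD('n)) * ?T)"
    by (subst nn_integral_multc) (simp_all only: nn_integral_cols_mult, measurable)
  also have "\<dots> = ?T * ennreal ((norm (restr (- S) x))\<^sup>2 + (norm v)\<^sup>2 / real CARD('n))"
  proof -
    have "ennreal (real CARD('n) * (norm (restr (- S) x))\<^sup>2 + (norm v)\<^sup>2) * ennreal (1 / real CARD('n))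
        = ennreal ((norm (restr (- S) x))\<^sup>2 + (norm v)\<^sup>2 / real CARD('n))"
      by (simp add: ennreal_mult[symmetric] add_divide_distrib del: ennreal_plus)
    then show ?thesis by (simp only: mult.assoc[symmetric] mult.commute[of ?T])
  qed
  finally show ?thesis .
qed

theorem theorem1:
  fixes M :: "'w measure"
    and X :: "'w \<Rightarrow> real^'p" and V :: "'w \<Rightarrow> real^'n"
    and Kx :: "real^'p^'p" and Kv :: "real^'n^'n"
    and S :: "'p set"
  assumes "prob_space M"
    and "X \<in> borel_measurable M" and "V \<in> borel_measurable M"
    and "\<And>i. integrable M (\<lambda>w. X w $ i)" and "\<And>i. prob_space.expectation M (\<lambda>w. X w $ i) = 0"
    and "\<And>i. integrable M (\<lambda>w. V w $ i)" and "\<And>i. prob_space.expectation M (\<lambda>w. V w $ i) = 0"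
    and "\<And>i j. integrable M (\<lambda>w. X w $ i * X w $ j)"
    and "\<And>i j. prob_space.expectation M (\<lambda>w. X w $ i * X w $ j) = Kx $ i $ j"
    and "\<And>i j. integrable M (\<lambda>w. V w $ i * V w $ j)"
    and "\<And>i j. prob_space.expectation M (\<lambda>w. V w $ i * V w $ j) = Kv $ i $ j"
    and "\<And>i j. integrable M (\<lambda>w. X w $ i * V w $ j)"
    and "\<And>i j. prob_space.expectation M (\<lambda>w. X w $ i * V w $ j) = 0"
    and "S \<noteq> {}"
  shows "(\<integral>\<^sup>+ A. (\<integral>\<^sup>+ w. ennreal (sq_err_S S A (X w) (V w)) \<partial>M) \<partial>(gaussian_matrix :: (real^'p^'n) measure))
       = ennreal ((\<Sum>k\<in>S. Kx $ k $ k) * (1 - real (min (card S) CARD('n)) / real (card S)))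
         + gamma_S (card S) CARD('n)
           * ennreal ((\<Sum>k\<in>-S. Kx $ k $ k) + (1 / real CARD('n)) * trace Kv)"
proof -
  interpret M: prob_space M by fact
  note [measurable] = \<open>X \<in> borel_measurable M\<close> \<open>V \<in> borel_measurable M\<close>
  let ?\<mu> = "std_gaussian :: (real^'p^'n) measure"
  let ?r = "real (min (card S) CARD('n))"
  let ?c = "1 - ?r / real (card S)"
  obtain W :: "real^'p^'n \<Rightarrow> real^'n^'p" where W [measurable]: "W \<in> borel_measurable borel"
    and W_cols: "\<And>A. W (cols S A) = W A"
    and AE: "AE A in std_gaussian. is_pinv (cols S A) (W A)"
    and AE_trace: "AE A in std_gaussian. trace (W A ** cols S A) = ?r"
    and T: "(\<integral>\<^sup>+A. ennreal (trace (transpose (W A) ** W A)) \<partial>std_gaussian) = gamma_S (card S) CARD('n)"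
    using gaussian_pinv_exists[OF \<open>S \<noteq> {}\<close>] by blast
  have c: "0 \<le> ?c" by (simp add: divide_le_eq_1 card_gt_0_iff)
  have moment: "(\<integral>\<^sup>+w. ennreal (\<Sum>k\<in>C. (X w $ k)\<^sup>2) \<partial>M) = ennreal (\<Sum>k\<in>C. Kx $ k $ k)" for C
    using assms(8,9) by (subst nn_integral_eq_integral) (auto simp: power2_eq_square sum_nonneg)
  have moment_V: "(\<integral>\<^sup>+w. ennreal ((norm (V w))\<^sup>2) \<partial>M) = ennreal (trace Kv)"
    using assms(10,11)
    by (subst nn_integral_eq_integral) (auto simp: power2_norm_eq_inner inner_vec_def trace_def sum_nonneg)
  \<comment> \<open>Diagonal entries are second moments. Their sign matters because
    \<open>ennreal\<close> sends negative reals to 0.\<close>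
  have Kx_nonneg: "0 \<le> (\<Sum>k\<in>C. Kx $ k $ k)" for C
    using assms(9) by (intro sum_nonneg) (metis Bochner_Integration.integral_nonneg zero_le_square)
  have Kv_nonneg: "0 \<le> trace Kv"
    unfolding trace_def using assms(11)
    by (intro sum_nonneg) (metis Bochner_Integration.integral_nonneg zero_le_square)
  have "(\<integral>\<^sup>+A. (\<integral>\<^sup>+w. ennreal (sq_err_S S A (X w) (V w)) \<partial>M) \<partial>gaussian_matrix)
      = (\<integral>\<^sup>+A. (\<integral>\<^sup>+w. ennreal ((norm (restr S (X w) - W A *v (A *v X w + V w)))\<^sup>2) \<partial>M) \<partial>?\<mu>)"
    unfolding gaussian_matrix_eq
    by (rule nn_integral_cong_AE, use AE in eventually_elim) (simp add: sq_err_S_eq)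
  also have "\<dots> = (\<integral>\<^sup>+w. (\<integral>\<^sup>+A. ennreal ((norm (restr S (X w) - W A *v (A *v X w + V w)))\<^sup>2) \<partial>?\<mu>) \<partial>M)"
  \<comment> \<open>Nonnegativity permits the exchange even when the mean is infinite; afterwards
    \<open>X w\<close> and \<open>V w\<close> are fixed vectors in the integral over
    \<open>A\<close>.\<close>
  proof (rule pair_sigma_finite.Fubini'[symmetric])
    show "pair_sigma_finite ?\<mu> M"
      by (intro pair_sigma_finite.intro std_gaussian.sigma_finite_measure_axioms M.sigma_finite_measure_axioms)
  qed measurable
  also have "\<dots> = (\<integral>\<^sup>+w. ennreal ((norm (restr S (X w)))\<^sup>2 * ?c) + gamma_S (card S) CARD('n)
      * ennreal ((norm (restr (- S) (X w)))\<^sup>2 + (norm (V w))\<^sup>2 / real CARD('n)) \<partial>M)"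
    by (subst nn_integral_sq_err[OF W W_cols AE AE_trace _ \<open>S \<noteq> {}\<close>]) (simp_all add: T)
  also have "\<dots> = (\<integral>\<^sup>+w. ennreal (\<Sum>k\<in>S. (X w $ k)\<^sup>2) * ennreal ?c + gamma_S (card S) CARD('n)
      * (ennreal (\<Sum>k\<in>- S. (X w $ k)\<^sup>2) + ennreal ((norm (V w))\<^sup>2) * ennreal (1 / real CARD('n))) \<partial>M)"
    using c by (simp add: norm_restr ennreal_mult[symmetric] sum_nonneg)
  also have "\<dots> = ennreal (\<Sum>k\<in>S. Kx $ k $ k) * ennreal ?c + gamma_S (card S) CARD('n)
      * (ennreal (\<Sum>k\<in>- S. Kx $ k $ k) + ennreal (trace Kv) * ennreal (1 / real CARD('n)))"
    by (simp add: nn_integral_add nn_integral_cmult nn_integral_multc moment moment_V)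
  also have "\<dots> = ennreal ((\<Sum>k\<in>S. Kx $ k $ k) * ?c) + gamma_S (card S) CARD('n)
      * ennreal ((\<Sum>k\<in>- S. Kx $ k $ k) + 1 / real CARD('n) * trace Kv)"
    using c Kx_nonneg Kv_nonneg by (simp add: ennreal_mult[symmetric])
  finally show ?thesis .
qed

end
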